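(* Let $\Omega_0$ and $\Omega$ be closed and open sets, respectively, of the complex plane, with $\Omega_0\subset\Omega\subset\mathbb{C}$. Let $f(z)$ be an analytic function on $\Omega\setminus\Omega_0$, and let $z_1,\dots,z_p\in\Omega_0$ be $p$ different points, with multiplicities $m_1,\dots,m_p$ (positive integers) and $m=m_1+\dots+m_p$. Then, for any $z\in\Omega\setminus\Omega_0$, $f(z)$ has the multi-point Laurent expansion $$f(z)=\sum_{n=0}^{N-1}q_{n,m}(z)\prod_{k=1}^p(z-z_k)^{nm_k}+\sum_{n=0}^{N-1}t_{n,m}(z)\prod_{k=1}^p(z-z_k)^{-(n+1)m_k}+r_N(z),$$ where $q_{n,m}(z)$ is the polynomial of degree $m-1$ $$q_{n,m}(z)=\sum_{j=1}^p\frac{\prod_{k=1,k\ne j}^p(z-z_k)^{m_k}}{\prod_{k=1,k\ne j}^p(z_j-z_k)^{m_k}}\sum_{l=0}^{m_j-1}a_{n,j,l}(z-z_j)^l$$ and the coefficients $a_{n,j,l}$ are given by the Cauchy integral $$a_{n,j,l}=\frac{1}{2\pi i}\int_{\Gamma_1}\frac{f(w)\,dw}{(w-z_j)^{l+1}\prod_{k=1}^p(w-z_k)^{nm_k}}.$$ Also, $t_{n,m}(z)$ is the polynomial of degree $m-1$ $$t_{n,m}(z)=\sum_{j=1}^p\frac{\prod_{k=1,k\ne j}^p(z-z_k)^{m_k}}{\prod_{k=1,k\ne j}^p(z_j-z_k)^{m_k}}\sum_{l=0}^{m_j-1}b_{n,j,l}(z-z_j)^l,$$ where the coefficients $b_{n,j,l}$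 are given by the Cauchy integral $$b_{n,j,l}=\frac{1}{2\pi i}\int_{\Gamma_2}\prod_{k=1}^p(w-z_k)^{(n+1)m_k}\,\frac{f(w)\,dw}{(w-z_j)^{l+1}}.$$ The remainder term $r_N(z)$ is given by the Cauchy integrals $$r_N(z)=\frac{1}{2\pi i}\int_{\Gamma_1}\frac{f(w)\,dw}{(w-z)\prod_{k=1}^p(w-z_k)^{Nm_k}}\prod_{k=1}^p(z-z_k)^{Nm_k}-\frac{1}{2\pi i}\int_{\Gamma_2}\prod_{k=1}^p(w-z_k)^{Nm_k}\,\frac{f(w)\,dw}{w-z}\ \frac{1}{\prod_{k=1}^p(z-z_k)^{Nm_k}}.$$ In these integrals, the contours of integration $\Gamma_1$ and $\Gamma_2$ are simple closed loops contained in $\Omega\setminus\Omega_0$ which encircle the points $z_1,\dots,z_p$ in the counterclockwise direction. Moreover, $z$ is not inside $\Gamma_2$, whereas $\Gamma_1$ encircles $\Gamma_2$ and the point $z$. The expansion is convergent for $z$ inside the "lemniscate annulus" $$A_p=\Big\{z\in\Omega\setminus\Omega_0:\ r_2<\prod_{k=1}^p|z-z_k|^{m_k}<r_1\Big\},$$ where $$r_1=\inf_{w\in\mathbb{C}\setminus\Omega}\ \prod_{k=1}^p|w-z_k|^{m_k},\qquad r_2=\sup_{w\in\Omega_0}\ \prod_{k=1}^p|w-z_k|^{m_k}.$$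
   Context: Empty sums are zero and empty products equal one. Convergence of the expansion means that $r_N(z)\to0$ as $N\to\infty$. If $\Omega=\mathbb{C}$, the infimum over the empty set is understood as $r_1=+\infty$.
   Formalization: In q and t, each term a(z-z_j)^l, b(z-z_j)^l is multiplied by the Taylor polynomial at z_j, order below m_j-l, of prod_{k≠j}((z_j-z_k)/(z-z_k))^{m_k}; degree is at most m-1. Between loops lies in Ω∖Ω_0; for convergence Γ_2 encircles Ω_0 and inside of Γ_1 is in Ω. *)

theory Defs
  imports "HOL-Complex_Analysis.Complex_Analysis"
begin

text \<open>The points are \<open>zs 1, \<dots>, zs p\<close> with multiplicities \<open>m 1, \<dots>, m p\<close>.\<close>

definition ccw_loop_in :: "complex set \<Rightarrow> (real \<Rightarrow> complex) \<Rightarrow> bool" where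
  "ccw_loop_in D \<gamma> \<longleftrightarrow>
     valid_path \<gamma> \<and> simple_path \<gamma> \<and> pathfinish \<gamma> = pathstart \<gamma> \<and> path_image \<gamma> \<subseteq> D \<and>
     (\<forall>w \<in> inside (path_image \<gamma>). winding_number \<gamma> w = 1)"

definition encircles :: "(real \<Rightarrow> complex) \<Rightarrow> complex set \<Rightarrow> bool" where
  "encircles \<gamma> S \<longleftrightarrow> S \<subseteq> inside (path_image \<gamma>)"

definition laurent_a ::
  "nat \<Rightarrow> (nat \<Rightarrow> complex) \<Rightarrow> (nat \<Rightarrow> nat) \<Rightarrow> (complex \<Rightarrow> complex) \<Rightarrow> (real \<Rightarrow> complex)
     \<Rightarrow> nat \<Rightarrow> nat \<Rightarrow> nat \<Rightarrow> complex" where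
  "laurent_a p zs m f \<Gamma>1 n j l =
     1 / (2 * of_real pi * \<i>) *
     contour_integral \<Gamma>1
       (\<lambda>w. f w / ((w - zs j) ^ (l + 1) * (\<Prod>k=1..p. (w - zs k) ^ (n * m k))))"

definition laurent_b ::
  "nat \<Rightarrow> (nat \<Rightarrow> complex) \<Rightarrow> (nat \<Rightarrow> nat) \<Rightarrow> (complex \<Rightarrow> complex) \<Rightarrow> (real \<Rightarrow> complex)
     \<Rightarrow> nat \<Rightarrow> nat \<Rightarrow> nat \<Rightarrow> complex" where
  "laurent_b p zs m f \<Gamma>2 n j l =
     1 / (2 * of_real pi * \<i>) *
     contour_integral \<Gamma>2
       (\<lambda>w. (\<Prod>k=1..p. (w - zs k) ^ ((n + 1) * m k)) * (f w / (w - zs j) ^ (l + 1)))"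

definition laurent_remainder ::
  "nat \<Rightarrow> (nat \<Rightarrow> complex) \<Rightarrow> (nat \<Rightarrow> nat) \<Rightarrow> (complex \<Rightarrow> complex)
     \<Rightarrow> (real \<Rightarrow> complex) \<Rightarrow> (real \<Rightarrow> complex) \<Rightarrow> nat \<Rightarrow> complex \<Rightarrow> complex" where
  "laurent_remainder p zs m f \<Gamma>1 \<Gamma>2 N z =
     1 / (2 * of_real pi * \<i>) *
       contour_integral \<Gamma>1 (\<lambda>w. f w / ((w - z) * (\<Prod>k=1..p. (w - zs k) ^ (N * m k)))) *
       (\<Prod>k=1..p. (z - zs k) ^ (N * m k))
     - 1 / (2 * of_real pi * \<i>) *
       contour_integral \<Gamma>2 (\<lambda>w. (\<Prod>k=1..p. (w - zs k) ^ (N * m k)) * (f w / (w - z))) *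
       (1 / (\<Prod>k=1..p. (z - zs k) ^ (N * m k)))"

text \<open>
  \<open>hermite_weight p zs m j s\<close> is the \<open>s\<close>-th Taylor coefficient at \<open>zs j\<close> of
  \<open>\<Prod>k\<noteq>j. ((zs j - zs k) / (u - zs k)) ^ m k\<close>. Multiplication by this function cancels the
  cofactor \<open>\<Prod>k\<noteq>j. ((u - zs k) / (zs j - zs k)) ^ m k\<close> in Hermite's interpolation formula.
\<close>

definition hermite_weight ::
  "nat \<Rightarrow> (nat \<Rightarrow> complex) \<Rightarrow> (nat \<Rightarrow> nat) \<Rightarrow> nat \<Rightarrow> nat \<Rightarrow> complex" where
  "hermite_weight p zs m j s =
     (deriv ^^ s) (\<lambda>u. \<Prod>k\<in>{1..p} - {j}. ((zs j - zs k) / (u - zs k)) ^ m k) (zs j) / fact s"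

text \<open>
  The polynomial with local data \<open>c j l\<close>. Without the innermost sum over \<open>s\<close> (the Taylor
  polynomial of the function above) this would be
  \<open>\<Sum>j. (\<Prod>k\<noteq>j. (z - zs k) ^ m k / (zs j - zs k) ^ m k) * (\<Sum>l<m j. c j l * (z - zs j) ^ l)\<close>,
  whose Taylor coefficient of order \<open>l < m j\<close> at \<open>zs j\<close> in general differs from \<open>c j l\<close>
  when \<open>l > 0\<close> and \<open>p > 1\<close>. The two agree if \<open>p = 1\<close> or if all points are simple; see
  \<open>poly_multipoint_poly_simple\<close>.
\<close>

definition multipoint_poly ::
  "nat \<Rightarrow> (nat \<Rightarrow> complex) \<Rightarrow> (nat \<Rightarrow> nat) \<Rightarrow> (nat \<Rightarrow> nat \<Rightarrow> complex) \<Rightarrow> complex poly" where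
  "multipoint_poly p zs m c =
     (\<Sum>j=1..p.
        smult (1 / (\<Prod>k\<in>{1..p} - {j}. (zs j - zs k) ^ m k))
          (\<Prod>k\<in>{1..p} - {j}. [:- zs k, 1:] ^ m k) *
        (\<Sum>l<m j. smult (c j l) ([:- zs j, 1:] ^ l) *
           (\<Sum>s<m j - l. smult (hermite_weight p zs m j s) ([:- zs j, 1:] ^ s))))"

definition laurent_q ::
  "nat \<Rightarrow> (nat \<Rightarrow> complex) \<Rightarrow> (nat \<Rightarrow> nat) \<Rightarrow> (complex \<Rightarrow> complex) \<Rightarrow> (real \<Rightarrow> complex)
     \<Rightarrow> nat \<Rightarrow> complex poly" where
  "laurent_q p zs m f \<Gamma>1 n = multipoint_poly p zs m (laurent_a p zs m f \<Gamma>1 n)"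

definition laurent_t ::
  "nat \<Rightarrow> (nat \<Rightarrow> complex) \<Rightarrow> (nat \<Rightarrow> nat) \<Rightarrow> (complex \<Rightarrow> complex) \<Rightarrow> (real \<Rightarrow> complex)
     \<Rightarrow> nat \<Rightarrow> complex poly" where
  "laurent_t p zs m f \<Gamma>2 n = multipoint_poly p zs m (laurent_b p zs m f \<Gamma>2 n)"

definition lemniscate_r1 ::
  "nat \<Rightarrow> (nat \<Rightarrow> complex) \<Rightarrow> (nat \<Rightarrow> nat) \<Rightarrow> complex set \<Rightarrow> ereal" where
  "lemniscate_r1 p zs m \<Omega> = (INF w\<in>UNIV - \<Omega>. ereal (\<Prod>k=1..p. norm (w - zs k) ^ m k))"

definition lemniscate_r2 ::
  "nat \<Rightarrow> (nat \<Rightarrow> complex) \<Rightarrow> (nat \<Rightarrow> nat) \<Rightarrow> complex set \<Rightarrow> ereal" where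
  "lemniscate_r2 p zs m \<Omega>0 = (SUP w\<in>\<Omega>0. ereal (\<Prod>k=1..p. norm (w - zs k) ^ m k))"

definition lemniscate_annulus ::
  "nat \<Rightarrow> (nat \<Rightarrow> complex) \<Rightarrow> (nat \<Rightarrow> nat) \<Rightarrow> complex set \<Rightarrow> complex set \<Rightarrow> complex set" where
  "lemniscate_annulus p zs m \<Omega> \<Omega>0 =
     {z \<in> \<Omega> - \<Omega>0.
        lemniscate_r2 p zs m \<Omega>0 < ereal (\<Prod>k=1..p. norm (z - zs k) ^ m k) \<and>
        ereal (\<Prod>k=1..p. norm (z - zs k) ^ m k) < lemniscate_r1 p zs m \<Omega>}"

lemma hermite_weight_0:
  assumes "inj_on zs {1..p}" "j \<in> {1..p}"
  shows "hermite_weight p zs m j 0 = 1"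
proof -
  have "zs j \<noteq> zs k" if "k \<in> {1..p} - {j}" for k
    using assms that by (auto dest: inj_onD)
  then show ?thesis
    by (simp add: hermite_weight_def)
qed

lemma hermite_weight_single:
  assumes "0 < s"
  shows "hermite_weight 1 zs m 1 s = 0"
proof -
  have "(deriv ^^ s) (\<lambda>u::complex. 1::complex) = (\<lambda>u. 0)" if "0 < s" for s
    using that
  proof (induction s)
    case (Suc s)
    then show ?case by (cases "s = 0") simp_all
  qed simp
  from this[OF assms] show ?thesis
    by (simp add: hermite_weight_def)
qed

lemma poly_multipoint_poly_simple:
  assumes inj: "inj_on zs {1..p}" and simple: "p = 1 \<or> (\<forall>k\<in>{1..p}. m k = 1)"
  shows "poly (multipoint_poly p zs m c) z =
    (\<Sum>j=1..p.
       (\<Prod>k\<in>{1..p} - {j}. (z - zs k) ^ m k) / (\<Prod>k\<in>{1..p} - {j}. (zs j - zs k) ^ m k) *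
       (\<Sum>l<m j. c j l * (z - zs j) ^ l))"
proof -
  have W: "(\<Sum>s<m j - l. smult (hermite_weight p zs m j s) ([:- zs j, 1:] ^ s)) = 1"
    if j: "j \<in> {1..p}" and l: "l < m j" for j l
  proof -
    obtain d where d: "m j - l = Suc d" using l by (metis Suc_diff_Suc)
    have z: "hermite_weight p zs m j (Suc s) = 0" if "s < d" for s
    proof -
      have "m j \<noteq> 1" using that d by auto
      then have "p = 1" "j = 1" using simple j by auto
      then show ?thesis using hermite_weight_single[of "Suc s" zs m] by simp
    qed
    show ?thesis
      unfolding d sum.lessThan_Suc_shift using hermite_weight_0[OF inj j] z by simp
  qed
  show ?thesis
    unfolding multipoint_poly_def poly_sum
  proof (rule sum.cong[OF refl])
    fix j assume j: "j \<in> {1..p}"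
    have "(\<Sum>l<m j. smult (c j l) ([:- zs j, 1:] ^ l) *
           (\<Sum>s<m j - l. smult (hermite_weight p zs m j s) ([:- zs j, 1:] ^ s)))
        = (\<Sum>l<m j. smult (c j l) ([:- zs j, 1:] ^ l))"
      using W[OF j] by (intro sum.cong) auto
    then show "poly (smult (1 / (\<Prod>k\<in>{1..p} - {j}. (zs j - zs k) ^ m k))
          (\<Prod>k\<in>{1..p} - {j}. [:- zs k, 1:] ^ m k) *
        (\<Sum>l<m j. smult (c j l) ([:- zs j, 1:] ^ l) *
           (\<Sum>s<m j - l. smult (hermite_weight p zs m j s) ([:- zs j, 1:] ^ s)))) z =
       (\<Prod>k\<in>{1..p} - {j}. (z - zs k) ^ m k) / (\<Prod>k\<in>{1..p} - {j}. (zs j - zs k) ^ m k) *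
       (\<Sum>l<m j. c j l * (z - zs j) ^ l)"
      by (simp add: poly_sum poly_prod poly_power)
  qed
qed

end

theory Submission
  imports Defs "HOL-Computational_Algebra.Fundamental_Theorem_Algebra"
begin

text \<open>
  Put \<open>P x = \<Prod>k. (x - zs k) ^ m k\<close>. Since \<open>(1 - P z / P w) / (w - z)\<close> is the Hermite interpolant of
  \<open>u \<mapsto> 1 / (w - u)\<close>, the coefficients satisfy \<open>q n z = A n - P z * A (n + 1)\<close> and
  \<open>t n z = B (n + 1) - P z * B n\<close>, where \<open>A n\<close> and \<open>B n\<close> are the Cauchy integrals in the remainder.
  Both sums telescope, and what is left is Cauchy's formula \<open>f z = A 0 - B 0\<close> for the region
  between the two loops.

  For the convergence, split \<open>f = f1 + f2\<close> with \<open>f1\<close> analytic on \<open>\<Omega>\<close> and \<open>f2\<close> analytic off \<open>\<Omega>0\<close>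
  and bounded at infinity; only \<open>f1\<close> contributes to \<open>A n\<close> (\<open>n > 0\<close>) and only \<open>f2\<close> to \<open>B n\<close>. The
  generating function of \<open>A (n + 1)\<close> is the sum of the residues of \<open>f1 w / ((w - z) * (P w - t))\<close> at \<open>z\<close>
  and at the solutions of \<open>P w = t\<close>. It is analytic for \<open>\<bar>t\<bar> < r1\<close>, so its Taylor series converges at
  \<open>t = P z\<close>. For \<open>B n\<close> the same sum with \<open>f2\<close> is used at \<open>t = 1 / s\<close>, where \<open>\<bar>s\<bar> < 1 / r2\<close>.
\<close>

section \<open>Hermite interpolation of the Cauchy kernel\<close>

lemma pcompose_power: "pcompose (q ^ n) r = pcompose q r ^ n"
  for q r :: "'a::comm_semiring_1 poly"
  by (induction n) (simp_all add: pcompose_1 pcompose_mult)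

text \<open>Shifting the variable moves \<open>a\<close> to 0, where divisibility by a power can be
  read off the low coefficients; shifting back transports the factorization.\<close>

lemma linear_power_dvdI:
  fixes q :: "'a::comm_ring_1 poly"
  assumes "\<And>i. i < n \<Longrightarrow> coeff (pcompose q [:a, 1:]) i = 0"
  shows "[:- a, 1:] ^ n dvd q"
proof -
  have "monom 1 n dvd pcompose q [:a, 1:]"
    using assms by (simp add: monom_1_dvd_iff')
  then obtain r where r: "pcompose q [:a, 1:] = monom 1 n * r" ..
  have "q = pcompose (pcompose q [:a, 1:]) [:- a, 1:]"
    by (simp add: pcompose_assoc [symmetric] pcompose_pCons)
  also have "\<dots> = [:- a, 1:] ^ n * pcompose r [:- a, 1:]"
    by (simp add: r pcompose_mult monom_altdef pcompose_power pcompose_pCons pcompose_smult)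
  finally show ?thesis ..
qed

text \<open>Induction on the points: the product already split off does not vanish at the new point,
  so the whole order of \<open>q\<close> there sits in the quotient \<open>r\<close>.\<close>

lemma prod_linear_powers_dvd:
  fixes q :: "'a::idom poly"
  assumes "finite A" "inj_on x A" "\<And>k. k \<in> A \<Longrightarrow> [:- x k, 1:] ^ m k dvd q"
  shows "(\<Prod>k\<in>A. [:- x k, 1:] ^ m k) dvd q"
  using assms
proof (induction A rule: finite_induct)
  case (insert j A)
  then obtain r where r: "q = (\<Prod>k\<in>A. [:- x k, 1:] ^ m k) * r"
    by auto
  have nz: "poly (\<Prod>k\<in>A. [:- x k, 1:] ^ m k) (x j) \<noteq> 0"
    using insert.hyps insert.prems(1) by (force simp: poly_prod)
  have "[:- x j, 1:] ^ m j dvd r"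
  proof (cases "q = 0")
    case True
    then show ?thesis using r nz by auto
  next
    case False
    then have "m j \<le> order (x j) q"
      using insert.prems(2)[of j] by (simp add: order_divides)
    also have "\<dots> = order (x j) r"
      using False nz by (simp add: r order_mult order_0I)
    finally show ?thesis
      by (simp add: order_divides)
  qed
  then show ?case
    using insert.hyps by (simp add: r mult.commute mult_dvd_mono)
qed simp

text \<open>Cutting the weights off at \<open>s < m j - l\<close> keeps every local term at degree
  at most \<open>m j - 1\<close>; the cofactor supplies the other multiplicities.\<close>

lemma degree_multipoint_poly:
  "degree (multipoint_poly p zs m c) \<le> (\<Sum>k=1..p. m k) - 1"
  unfolding multipoint_poly_def
proof (intro degree_sum_le)
  fix j assume j: "j \<in> {1..p}"
  let ?C = "smult (1 / (\<Prod>k\<in>{1..p} - {j}. (zs j - zs k) ^ m k))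
      (\<Prod>k\<in>{1..p} - {j}. [:- zs k, 1:] ^ m k)"
  let ?L = "\<lambda>l. smult (c j l) ([:- zs j, 1:] ^ l) *
      (\<Sum>s<m j - l. smult (hermite_weight p zs m j s) ([:- zs j, 1:] ^ s))"
  have "degree ?C \<le> (\<Sum>k\<in>{1..p} - {j}. m k)"
    by (rule order_trans[OF degree_smult_le order_trans[OF degree_prod_sum_le]])
      (simp_all add: degree_linear_power)
  moreover have "degree (?L l) \<le> m j - 1" if "l < m j" for l
  proof -
    have "degree (\<Sum>s<m j - l. smult (hermite_weight p zs m j s) ([:- zs j, 1:] ^ s)) \<le> m j - l - 1"
      by (intro degree_sum_le order_trans[OF degree_smult_le]) (auto simp: degree_linear_power)
    moreover have "degree (smult (c j l) ([:- zs j, 1:] ^ l)) \<le> l"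
      by (rule order_trans[OF degree_smult_le]) (simp add: degree_linear_power)
    ultimately show ?thesis
      using that by (intro order_trans[OF degree_mult_le]) linarith
  qed
  then have "degree (\<Sum>l<m j. ?L l) \<le> m j - 1"
    by (intro degree_sum_le) auto
  ultimately have le: "degree (?C * (\<Sum>l<m j. ?L l)) \<le> (\<Sum>k\<in>{1..p} - {j}. m k) + (m j - 1)"
    by (intro order_trans[OF degree_mult_le] add_mono)
  have sum: "(\<Sum>k=1..p. m k) = m j + (\<Sum>k\<in>{1..p} - {j}. m k)"
    using j by (simp add: sum.remove)
  show "degree (?C * (\<Sum>l<m j. ?L l)) \<le> (\<Sum>k=1..p. m k) - 1"
  \<comment> \<open>For \<open>m j = 0\<close> the bound \<open>le\<close> misses the goal by one,
    as \<open>m j - 1\<close> is truncated at 0, but then the inner sum is empty.\<close>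
  proof (cases "m j = 0")
    case False
    with le sum show ?thesis by linarith
  qed simp
qed simp

context
  fixes p :: nat and zs :: "nat \<Rightarrow> complex" and m :: "nat \<Rightarrow> nat"
  assumes inj: "inj_on zs {1..p}"
begin

text \<open>The weights are the Taylor coefficients at \<open>zs j\<close> of the reciprocal
  \<open>g\<close> of the cofactor \<open>?C\<close>. So \<open>?W\<close> is a Taylor polynomial of
  \<open>g\<close>, and \<open>?C * ?W\<close> agrees with \<open>?C * g = 1\<close> below order
  \<open>d\<close>.\<close>

lemma cofactor_hermite_weight_dvd:
  assumes j: "j \<in> {1..p}"
  shows "[:- zs j, 1:] ^ d dvd
    smult (1 / (\<Prod>k\<in>{1..p} - {j}. (zs j - zs k) ^ m k)) (\<Prod>k\<in>{1..p} - {j}. [:- zs k, 1:] ^ m k)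
      * (\<Sum>s<d. smult (hermite_weight p zs m j s) ([:- zs j, 1:] ^ s)) - 1"
    (is "_ dvd ?C * ?W - 1")
proof (rule linear_power_dvdI)
  fix i assume i: "i < d"
  define g where "g = (\<lambda>u. \<Prod>k\<in>{1..p} - {j}. ((zs j - zs k) / (u - zs k)) ^ m k)"
  define C where "C = pcompose ?C [:zs j, 1:]"
  have ne: "zs j \<noteq> zs k" if "k \<in> {1..p} - {j}" for k
    using inj j that by (auto dest: inj_onD)
  have "g analytic_on {zs j}"
    unfolding g_def by (intro analytic_intros) (use ne in auto)
  then have G: "(\<lambda>x. g (zs j + x)) has_fps_expansion fps_expansion g (zs j)"
    by (rule analytic_at_imp_has_fps_expansion)
  have "poly C has_fps_expansion fps_of_poly C"
    by (simp add: has_fps_expansion_def)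
  from has_fps_expansion_mult[OF this G]
  have CG: "(\<lambda>x. poly C x * g (zs j + x)) has_fps_expansion (fps_of_poly C * fps_expansion g (zs j))" .
  \<comment> \<open>\<open>g\<close> cancels the cofactor only away from the other points, so the
    product is compared with 1 on a neighbourhood of 0 that avoids them.\<close>
  have "eventually (\<lambda>x. x \<in> - (\<lambda>k. zs k - zs j) ` ({1..p} - {j})) (nhds 0)"
  proof (rule eventually_nhds_in_open)
    show "open (- (\<lambda>k. zs k - zs j) ` ({1..p} - {j}))"
      by (intro open_Compl finite_imp_closed) auto
    show "0 \<in> - (\<lambda>k. zs k - zs j) ` ({1..p} - {j})"
      using ne by force
  qed
  then have "eventually (\<lambda>x. poly C x * g (zs j + x) = 1) (nhds 0)"
  proof eventually_elim
    case (elim x)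
    have nz: "zs j + x - zs k \<noteq> 0" if "k \<in> {1..p} - {j}" for k
    proof
      assume "zs j + x - zs k = 0"
      then have "x = zs k - zs j" by (simp add: algebra_simps)
      with elim that show False by blast
    qed
    show ?case
      unfolding C_def g_def
      by (simp add: poly_pcompose poly_prod prod_dividef power_divide)
        (use ne nz in \<open>auto simp: add_diff_eq algebra_simps\<close>)
  qed
  then have "(\<lambda>x. 1) has_fps_expansion (fps_of_poly C * fps_expansion g (zs j))"
    using CG unfolding has_fps_expansion_def by (auto elim: eventually_elim2)
  then have one: "fps_of_poly C * fps_expansion g (zs j) = 1"
    using fps_expansion_unique_complex has_fps_expansion_1 by blast
  have W: "pcompose ?W [:zs j, 1:] = (\<Sum>s<d. monom (hermite_weight p zs m j s) s)"
    by (simp add: pcompose_sum pcompose_smult pcompose_power pcompose_pCons monom_altdef)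
  have cW: "coeff (\<Sum>s<d. monom (hermite_weight p zs m j s) s) i = fps_expansion g (zs j) $ i"
    if "i < d" for i
    using that by (simp add: coeff_sum fps_expansion_def hermite_weight_def g_def)
  have "coeff (pcompose (?C * ?W - 1) [:zs j, 1:]) i =
      coeff (C * (\<Sum>s<d. monom (hermite_weight p zs m j s) s)) i - coeff 1 i"
    by (simp only: pcompose_diff pcompose_mult pcompose_1 W C_def coeff_diff)
  \<comment> \<open>A coefficient of index \<open>i < d\<close> of a product involves only
    coefficients up to \<open>i\<close>, so truncating the series of \<open>g\<close> at
    \<open>d\<close> is invisible.\<close>
  also have "coeff (C * (\<Sum>s<d. monom (hermite_weight p zs m j s) s)) i
      = (fps_of_poly C * fps_expansion g (zs j)) $ i"
    using i by (simp add: coeff_mult fps_mult_nth cW atLeast0AtMost del: coeff_sum)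
  also have "\<dots> - coeff 1 i = 0"
    by (simp add: one)
  finally show "coeff (pcompose (?C * ?W - 1) [:zs j, 1:]) i = 0" .
qed

text \<open>Modulo \<open>[:- zs j, 1:] ^ m j\<close> only the summand of index \<open>j\<close>
  survives, since every other cofactor contains that power. In it, cofactor times weight is 1 up to
  order \<open>m j - l\<close>, and the accompanying power \<open>l\<close> completes this to order
  \<open>m j\<close>.\<close>

lemma multipoint_poly_cong_mod:
  assumes j: "j \<in> {1..p}"
  shows "[:- zs j, 1:] ^ m j dvd multipoint_poly p zs m c - (\<Sum>l<m j. smult (c j l) ([:- zs j, 1:] ^ l))"
proof -
  define X where "X i = [:- zs i, 1:]" for i
  define C where "C i = smult (1 / (\<Prod>k\<in>{1..p} - {i}. (zs i - zs k) ^ m k))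
      (\<Prod>k\<in>{1..p} - {i}. X k ^ m k)" for i
  define W where "W i l = (\<Sum>s<m i - l. smult (hermite_weight p zs m i s) (X i ^ s))" for i l
  define Q where "Q i = C i * (\<Sum>l<m i. smult (c i l) (X i ^ l) * W i l)" for i
  have "multipoint_poly p zs m c = (\<Sum>i=1..p. Q i)"
    unfolding multipoint_poly_def Q_def C_def W_def X_def ..
  also have "\<dots> = Q j + (\<Sum>i\<in>{1..p} - {j}. Q i)"
    using j by (simp add: sum.remove)
  finally have *: "multipoint_poly p zs m c - (\<Sum>l<m j. smult (c j l) (X j ^ l))
      = (\<Sum>l<m j. smult (c j l) (X j ^ l * (C j * W j l - 1))) + (\<Sum>i\<in>{1..p} - {j}. Q i)"
    by (simp add: Q_def sum_distrib_left smult_diff_right sum_subtractf algebra_simps)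
  have "X j ^ m j dvd Q i" if "i \<in> {1..p} - {j}" for i
  proof -
    have "X j ^ m j dvd (\<Prod>k\<in>{1..p} - {i}. X k ^ m k)"
      using that j by (intro dvd_prodI) auto
    then show ?thesis
      unfolding Q_def C_def by (intro dvd_mult2 dvd_smult)
  qed
  moreover have "X j ^ m j dvd smult (c j l) (X j ^ l * (C j * W j l - 1))" if "l < m j" for l
  proof -
    have "X j ^ (m j - l) dvd C j * W j l - 1"
      unfolding X_def C_def W_def by (rule cofactor_hermite_weight_dvd[OF j])
    then have "X j ^ l * X j ^ (m j - l) dvd X j ^ l * (C j * W j l - 1)"
      by (rule mult_dvd_mono[OF dvd_refl])
    then show ?thesis
      using that by (intro dvd_smult) (simp add: power_add [symmetric])
  qed
  ultimately have "X j ^ m j dvd multipoint_poly p zs m c - (\<Sum>l<m j. smult (c j l) (X j ^ l))"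
    unfolding * by (intro dvd_add dvd_sum) auto
  then show ?thesis by (simp add: X_def)
qed

text \<open>
  As polynomials in \<open>x\<close>, the multipoint polynomial of \<open>1 / (w - x)\<close> is \<open>(1 - P x / P w) / (w - x)\<close>
  with \<open>P = \<Prod>k. (x - zs k) ^ m k\<close>: the polynomial \<open>1 - (w - x) * Q x\<close> vanishes to order \<open>m j\<close> at
  every \<open>zs j\<close>, so it is a multiple of \<open>P\<close>, and by degree the factor is constant.
\<close>

lemma multipoint_poly_kernel:
  assumes w: "w \<notin> zs ` {1..p}" "w \<noteq> z" and pos: "(\<Sum>k=1..p. m k) > 0"
  shows "poly (multipoint_poly p zs m (\<lambda>j l. 1 / (w - zs j) ^ (l + 1))) z =
    (1 - (\<Prod>k=1..p. (z - zs k) ^ m k) / (\<Prod>k=1..p. (w - zs k) ^ m k)) / (w - z)"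
proof -
  define Q where "Q = multipoint_poly p zs m (\<lambda>j l. 1 / (w - zs j) ^ (l + 1))"
  define D where "D = 1 - [:w, - 1:] * Q"
  define P where "P = (\<Prod>k\<in>{1..p}. [:- zs k, 1:] ^ m k)"
  have "[:- zs j, 1:] ^ m j dvd D" if j: "j \<in> {1..p}" for j
  proof -
    define X where "X = [:- zs j, 1:]"
    define a where "a = w - zs j"
    have a: "a \<noteq> 0" using w j by (auto simp: a_def)
    \<comment> \<open>\<open>S\<close> is the Taylor polynomial of \<open>1 / (w - x)\<close> at
      \<open>zs j\<close>, a geometric sum with ratio \<open>X / a\<close>; \<open>geom\<close> is
      its closed form.\<close>
    define S where "S = (\<Sum>l<m j. smult (1 / a ^ (l + 1)) (X ^ l))"
    have wX: "[:w, - 1:] = [:a:] - X"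
      by (simp add: a_def X_def)
    have geom: "(\<Sum>l<n. smult (1 / a ^ (l + 1)) (X ^ l)) * ([:a:] - X) = 1 - smult (1 / a ^ n) (X ^ n)" for n
    proof (induction n)
      case (Suc n)
      have "(\<Sum>l<Suc n. smult (1 / a ^ (l + 1)) (X ^ l)) * ([:a:] - X)
          = 1 - smult (1 / a ^ n) (X ^ n) + smult (1 / a ^ (n + 1)) (X ^ n) * ([:a:] - X)"
        by (simp only: sum.lessThan_Suc ring_distribs(2) Suc)
      also have "\<dots> = 1 - smult (1 / a ^ Suc n) (X ^ Suc n)"
        using a by (simp add: algebra_simps smult_diff_right)
      finally show ?case .
    qed simp
    have *: "1 - L * Q = R - L * (Q - S)" if "L * S = 1 - R" for L R
      using that by (simp add: algebra_simps)
    from geom[of "m j"] have "[:w, - 1:] * S = 1 - smult (1 / a ^ m j) (X ^ m j)"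
      unfolding wX S_def by (simp add: mult.commute)
    then have "D = smult (1 / a ^ m j) (X ^ m j) - [:w, - 1:] * (Q - S)"
      unfolding D_def by (rule *)
    moreover have "X ^ m j dvd Q - S"
      using multipoint_poly_cong_mod[OF j, of "\<lambda>j l. 1 / (w - zs j) ^ (l + 1)"]
      by (simp add: Q_def S_def X_def a_def)
    ultimately show ?thesis
      unfolding X_def [symmetric] by (metis dvd_diff dvd_mult dvd_smult dvd_refl)
  qed
  then have "P dvd D"
    unfolding P_def by (intro prod_linear_powers_dvd inj) auto
  then obtain r where r: "D = P * r" ..
  have degP: "degree P = (\<Sum>k=1..p. m k)"
    by (simp add: P_def degree_prod_sum_eq degree_linear_power)
  \<comment> \<open>The factor \<open>w - x\<close> vanishes at \<open>w\<close>. This normalization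
    forces the constant factor to be \<open>1 / poly P w\<close>.\<close>
  have Dw: "poly D w = 1" by (simp add: D_def)
  have "degree D \<le> (\<Sum>k=1..p. m k)"
    unfolding D_def
  proof (intro degree_diff_le order_trans[OF degree_mult_le])
    \<comment> \<open>By \<open>pos\<close> the subtraction in the degree bound of \<open>Q\<close>
      is not truncated, so the linear factor raises the degree to at most that of
      \<open>P\<close>.\<close>
    show "degree [:w, - 1:] + degree Q \<le> (\<Sum>k=1..p. m k)"
      using degree_multipoint_poly[of p zs m "\<lambda>j l. 1 / (w - zs j) ^ (l + 1)"] pos
      unfolding Q_def by simp
  qed simp
  moreover have "r \<noteq> 0" "P \<noteq> 0" using Dw by (auto simp: r)
  ultimately have "degree r = 0"
    using degP by (simp add: r degree_mult_eq)
  then obtain e where e: "r = [:e:]" by (rule degree_eq_zeroE)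
  have P: "poly P x = (\<Prod>k=1..p. (x - zs k) ^ m k)" for x
    by (simp add: P_def poly_prod)
  have "poly P w * e = 1"
    using Dw by (simp add: r e mult.commute)
  then have nz: "poly P w \<noteq> 0" by auto
  then have "e = 1 / poly P w"
    using \<open>poly P w * e = 1\<close> by (simp add: field_simps)
  moreover have "1 - (w - z) * poly Q z = poly P z * e"
    using arg_cong[OF r, of "\<lambda>p. poly p z"] by (simp add: D_def e algebra_simps)
  ultimately have eq: "1 - (w - z) * poly Q z = poly P z / poly P w"
    by simp
  have "(w - z) * poly Q z = 1 - poly P z / poly P w"
    unfolding eq [symmetric] by simp
  then have "poly Q z = (1 - poly P z / poly P w) / (w - z)"
    using w by (simp add: eq_divide_eq mult.commute)
  then show ?thesis
    by (simp only: Q_def P)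
qed

end

section \<open>Residues between two loops\<close>

text \<open>\<open>\<gamma>1\<close>, a connecting path, \<open>\<gamma>2\<close> reversed and the
  connecting path reversed form one closed path. The connection cancels in integrals and winding
  numbers. Equality of the winding numbers off \<open>A\<close> makes the closed path
  null-homologous, so the residue theorem applies.\<close>

lemma Residue_theorem_two_loops:
  assumes "open S" "A \<subseteq> S" "connected A" and fin: "finite pts"
    and hol: "g holomorphic_on S - pts"
    and v: "valid_path \<gamma>1" "valid_path \<gamma>2"
    and loop: "pathfinish \<gamma>1 = pathstart \<gamma>1" "pathfinish \<gamma>2 = pathstart \<gamma>2"
    and im: "path_image \<gamma>1 \<subseteq> A - pts" "path_image \<gamma>2 \<subseteq> A - pts"
    and wn: "\<And>w. w \<notin> A \<Longrightarrow> winding_number \<gamma>1 w = winding_number \<gamma>2 w"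
  shows "contour_integral \<gamma>1 g - contour_integral \<gamma>2 g =
    2 * pi * \<i> * (\<Sum>x\<in>pts. (winding_number \<gamma>1 x - winding_number \<gamma>2 x) * residue g x)"
proof -
  let ?a = "pathstart \<gamma>1" and ?b = "pathstart \<gamma>2"
  have ab: "?a \<in> A - pts" "?b \<in> A - pts"
    using im pathstart_in_path_image by blast+
  \<comment> \<open>The residue theorem needs a connected domain. The connected set \<open>A\<close>
    contains both loops and lies in one component \<open>T\<close>, which stays connected without
    the finitely many poles, so the connecting path can avoid them.\<close>
  define T where "T = connected_component_set S ?a"
  have "open T" "connected T" "T \<subseteq> S"
    using \<open>open S\<close> unfolding T_def
    by (auto simp: open_connected_component connected_component_subset)
  have "A \<subseteq> T"
    unfolding T_def using ab assms(2,3) by (intro connected_component_maximal) auto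
  have "connected (T - pts)"
    using \<open>open T\<close> \<open>connected T\<close> fin by (intro connected_open_delete_finite) auto
  moreover have "open (T - pts)"
    using \<open>open T\<close> fin by (intro open_Diff finite_imp_closed)
  ultimately obtain c where "polynomial_function c" and c: "path_image c \<subseteq> T - pts"
      "pathstart c = ?a" "pathfinish c = ?b"
    using connected_open_polynomial_connected[of "T - pts" ?a ?b] ab \<open>A \<subseteq> T\<close> by blast
  then have vc: "valid_path c" by (simp add: valid_path_polynomial_function)
  define \<gamma> where "\<gamma> = \<gamma>1 +++ c +++ reversepath \<gamma>2 +++ reversepath c"
  have paths: "path \<gamma>1" "path \<gamma>2" "path c"
    using v vc by (auto intro: valid_path_imp_path)
  have v\<gamma>: "valid_path \<gamma>"
    unfolding \<gamma>_def using v vc loop c by (intro valid_path_join) (auto simp: valid_path_imp_reverse)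
  have im\<gamma>: "path_image \<gamma> \<subseteq> T - pts"
    unfolding \<gamma>_def using im \<open>A \<subseteq> T\<close> c loop paths
    by (auto simp: path_image_join)
  have wn\<gamma>: "winding_number \<gamma> x = winding_number \<gamma>1 x - winding_number \<gamma>2 x"
    if "x \<notin> path_image \<gamma>1 \<union> path_image \<gamma>2 \<union> path_image c" for x
    unfolding \<gamma>_def using that c loop paths
    by (simp add: winding_number_join winding_number_reversepath path_image_join)
  have int: "g contour_integrable_on \<eta>" if "valid_path \<eta>" "path_image \<eta> \<subseteq> T - pts" for \<eta>
    using that \<open>open (T - pts)\<close> hol \<open>T \<subseteq> S\<close>
    by (intro contour_integrable_holomorphic_simple[of g "T - pts"]) (auto intro: holomorphic_on_subset)
  have i1: "g contour_integrable_on \<gamma>1" and i2: "g contour_integrable_on \<gamma>2"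
    and ic: "g contour_integrable_on c"
    using int v vc im \<open>A \<subseteq> T\<close> c by blast+
  have "contour_integral \<gamma> g = contour_integral \<gamma>1 g - contour_integral \<gamma>2 g"
    unfolding \<gamma>_def using i1 i2 ic v vc loop c
    by (simp add: contour_integral_join contour_integrable_join contour_integrable_reversepath_eq
        contour_integral_reversepath valid_path_imp_reverse)
  moreover have "contour_integral \<gamma> g =
      2 * pi * \<i> * (\<Sum>x\<in>pts. winding_number \<gamma> x * residue g x)"
  proof -
    have 0: "winding_number \<gamma> x = 0" if "x \<notin> T" for x
    proof -
      have "x \<notin> A" "x \<notin> path_image \<gamma>1 \<union> path_image \<gamma>2 \<union> path_image c"
        using that im c(1) \<open>A \<subseteq> T\<close> by blast+
      then show ?thesis using wn\<gamma> wn by simp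
    qed
    have T: "T - pts \<inter> T = T - pts" by blast
    \<comment> \<open>Poles outside \<open>T\<close> are left out here and restored afterwards with
      winding number 0.\<close>
    have "contour_integral \<gamma> g =
        2 * pi * \<i> * (\<Sum>x\<in>pts \<inter> T. winding_number \<gamma> x * residue g x)"
    proof (rule Residue_theorem[OF \<open>open T\<close> \<open>connected T\<close> _ _ v\<gamma>])
      show "g holomorphic_on T - pts \<inter> T"
        using hol \<open>T \<subseteq> S\<close> unfolding T by (auto intro: holomorphic_on_subset)
      show "path_image \<gamma> \<subseteq> T - pts \<inter> T"
        using im\<gamma> unfolding T .
      show "pathfinish \<gamma> = pathstart \<gamma>"
        using c by (simp add: \<gamma>_def)
    qed (use fin 0 in auto)
    also have "(\<Sum>x\<in>pts \<inter> T. winding_number \<gamma> x * residue g x)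
        = (\<Sum>x\<in>pts. winding_number \<gamma> x * residue g x)"
      using fin 0 by (intro sum.mono_neutral_left) auto
    finally show ?thesis .
  qed
  moreover have "winding_number \<gamma> x = winding_number \<gamma>1 x - winding_number \<gamma>2 x" if "x \<in> pts" for x
    using that im c by (intro wn\<gamma>) auto
  ultimately show ?thesis by simp
qed

lemma ccw_loopD:
  assumes "ccw_loop_in D \<gamma>"
  shows "valid_path \<gamma>" "path \<gamma>" "simple_path \<gamma>" "pathfinish \<gamma> = pathstart \<gamma>" "path_image \<gamma> \<subseteq> D"
    and "compact (path_image \<gamma>)" "connected (path_image \<gamma>)" "path_image \<gamma> \<noteq> {}"
    and "\<And>w. w \<in> inside (path_image \<gamma>) \<Longrightarrow> winding_number \<gamma> w = 1"
    and "\<And>w. w \<in> outside (path_image \<gamma>) \<Longrightarrow> winding_number \<gamma> w = 0"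
    and "open (inside (path_image \<gamma>))" "open (outside (path_image \<gamma>))"
  using assms unfolding ccw_loop_in_def
  by (auto simp: valid_path_imp_path compact_valid_path_image connected_valid_path_image
      winding_number_zero_in_outside Jordan_inside_outside)

lemma ccw_loop_in_circlepath:
  assumes "r > 0"
  shows "ccw_loop_in (sphere a r) (circlepath a r)"
  using assms inside_frontier_eq_interior[of "cball a r"]
  by (auto simp: ccw_loop_in_def simple_path_circlepath winding_number_circlepath dist_norm norm_minus_commute)

lemma inside_circlepath:
  assumes "r > 0"
  shows "inside (path_image (circlepath a r)) = ball a r"
  using assms inside_frontier_eq_interior[of "cball a r"] by simp

text \<open>Off the loops, the difference of the winding numbers is the indicator function of the
  region between them, so only the poles in that region are counted.\<close>

lemma Residue_theorem_ccw_annulus: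
  assumes c1: "ccw_loop_in D1 \<gamma>1" and c2: "ccw_loop_in D2 \<gamma>2"
    and enc: "path_image \<gamma>2 \<subseteq> inside (path_image \<gamma>1)"
    and S: "open S" "path_image \<gamma>1 \<union> path_image \<gamma>2 \<union> inside (path_image \<gamma>1) \<inter> outside (path_image \<gamma>2) \<subseteq> S"
    and pts: "finite pts" "pts \<inter> path_image \<gamma>1 = {}" "pts \<inter> path_image \<gamma>2 = {}"
    and hol: "g holomorphic_on S - pts"
  shows "contour_integral \<gamma>1 g - contour_integral \<gamma>2 g =
    2 * pi * \<i> * (\<Sum>x\<in>pts \<inter> inside (path_image \<gamma>1) \<inter> outside (path_image \<gamma>2). residue g x)"
proof -
  let ?I1 = "inside (path_image \<gamma>1)" and ?O1 = "outside (path_image \<gamma>1)"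
  let ?I2 = "inside (path_image \<gamma>2)" and ?O2 = "outside (path_image \<gamma>2)"
  note c1 = ccw_loopD[OF c1] and c2 = ccw_loopD[OF c2]
  have sub: "?I2 \<subseteq> ?I1"
    using c1 c2 enc by (intro inside_inside_compact_connected) (auto intro: compact_imp_closed)
  have cases: "w \<in> path_image \<gamma>1 \<and> w \<notin> ?I1 \<and> w \<notin> ?O1 \<or> w \<notin> path_image \<gamma>1 \<and> w \<in> ?I1 \<and> w \<notin> ?O1
        \<or> w \<notin> path_image \<gamma>1 \<and> w \<notin> ?I1 \<and> w \<in> ?O1"
      "w \<in> path_image \<gamma>2 \<and> w \<notin> ?I2 \<and> w \<notin> ?O2 \<or> w \<notin> path_image \<gamma>2 \<and> w \<in> ?I2 \<and> w \<notin> ?O2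
        \<or> w \<notin> path_image \<gamma>2 \<and> w \<notin> ?I2 \<and> w \<in> ?O2" for w
    using union_with_inside[of "path_image \<gamma>1"] union_with_inside[of "path_image \<gamma>2"]
      inside_no_overlap[of "path_image \<gamma>1"] inside_no_overlap[of "path_image \<gamma>2"] by blast+
  have enc': "w \<in> path_image \<gamma>2 \<Longrightarrow> w \<in> ?I1" "w \<in> ?I2 \<Longrightarrow> w \<in> ?I1" for w
    using enc sub by blast+
  \<comment> \<open>\<open>A\<close> is the closed region between the loops. By unicoherence of the
    plane, two closed connected sets that cover it meet in a connected set.\<close>
  define A where "A = - ?O1 \<inter> - ?I2"
  have "connected A"
    unfolding A_def
  proof (rule unicoherentD[OF unicoherent_UNIV])
    show "connected (- ?O1)" "connected (- ?I2)"
      using c1 c2 connected_with_inside[of "path_image \<gamma>1"] connected_with_outside[of "path_image \<gamma>2"]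
      by (auto simp: union_with_inside union_with_outside compact_imp_closed)
    show "UNIV = - ?O1 \<union> - ?I2"
      using cases enc' by (metis ComplI UNIV_eq_I UnCI)
  qed (use c1 c2 in auto)
  have wn: "winding_number \<gamma>1 w - winding_number \<gamma>2 w = (if w \<in> ?I1 \<inter> ?O2 then 1 else 0)"
    if "w \<notin> path_image \<gamma>1" "w \<notin> path_image \<gamma>2" for w
    using that cases[of w] enc'[of w] c1(9,10)[of w] c2(9,10)[of w] by auto
  have "contour_integral \<gamma>1 g - contour_integral \<gamma>2 g =
    2 * pi * \<i> * (\<Sum>x\<in>pts. (winding_number \<gamma>1 x - winding_number \<gamma>2 x) * residue g x)"
  proof (rule Residue_theorem_two_loops[OF S(1) _ \<open>connected A\<close> pts(1) hol])
    show "A \<subseteq> S"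
    proof
      fix w assume "w \<in> A"
      then show "w \<in> S" using S(2) cases[of w] by (auto simp: A_def)
    qed
    show "path_image \<gamma>1 \<subseteq> A - pts" "path_image \<gamma>2 \<subseteq> A - pts"
      using cases enc' pts by (auto simp: A_def)
    show "winding_number \<gamma>1 w = winding_number \<gamma>2 w" if "w \<notin> A" for w
    proof -
      have "w \<notin> path_image \<gamma>1" "w \<notin> path_image \<gamma>2" "w \<notin> ?I1 \<inter> ?O2"
        using that cases[of w] enc'[of w] by (auto simp: A_def)
      then show ?thesis using wn[of w] by auto
    qed
  qed (use c1 c2 in auto)
  also have "(\<Sum>x\<in>pts. (winding_number \<gamma>1 x - winding_number \<gamma>2 x) * residue g x)
      = (\<Sum>x\<in>pts. if x \<in> ?I1 \<inter> ?O2 then residue g x else 0)"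
    using pts by (intro sum.cong refl) (subst wn, auto)
  also have "\<dots> = (\<Sum>x\<in>pts \<inter> ?I1 \<inter> ?O2. residue g x)"
    using pts(1) by (simp add: sum.If_cases Int_assoc Collect_conj_eq)
  finally show ?thesis .
qed

text \<open>The second loop degenerates to the constant path at the start of
  \<open>\<gamma>\<close>, with integral 0 and winding number 0 off that point.\<close>

lemma Residue_theorem_ccw_disc:
  assumes c: "ccw_loop_in D \<gamma>"
    and S: "open S" "path_image \<gamma> \<union> inside (path_image \<gamma>) \<subseteq> S"
    and pts: "finite pts" "pts \<inter> path_image \<gamma> = {}"
    and hol: "g holomorphic_on S - pts"
  shows "contour_integral \<gamma> g = 2 * pi * \<i> * (\<Sum>x\<in>pts \<inter> inside (path_image \<gamma>). residue g x)"
proof -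
  let ?I = "inside (path_image \<gamma>)" and ?a = "pathstart \<gamma>"
  note c = ccw_loopD[OF c]
  have a: "?a \<in> path_image \<gamma>" by (rule pathstart_in_path_image)
  have wn0: "winding_number (linepath ?a ?a) w = 0" if "w \<noteq> ?a" for w
    using that by simp
  have wn: "winding_number \<gamma> w = (if w \<in> ?I then 1 else 0)" if "w \<notin> path_image \<gamma>" for w
  proof (cases "w \<in> ?I")
    case False
    then have "w \<in> outside (path_image \<gamma>)"
      using that by (simp add: outside_inside)
    then show ?thesis using c(10) False by simp
  qed (use c(9) in simp)
  have "contour_integral \<gamma> g - contour_integral (linepath ?a ?a) g = 2 * pi * \<i> *
      (\<Sum>x\<in>pts. (winding_number \<gamma> x - winding_number (linepath ?a ?a) x) * residue g x)"
  proof (rule Residue_theorem_two_loops[OF S _ pts(1) hol])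
    show "connected (path_image \<gamma> \<union> ?I)"
      using c by (intro connected_with_inside) (auto intro: compact_imp_closed)
    show "winding_number \<gamma> w = winding_number (linepath ?a ?a) w" if "w \<notin> path_image \<gamma> \<union> ?I" for w
    proof -
      have "w \<noteq> ?a" using that a by blast
      then show ?thesis using that wn[of w] wn0 by simp
    qed
  qed (use c a pts in auto)
  also have "(\<Sum>x\<in>pts. (winding_number \<gamma> x - winding_number (linepath ?a ?a) x) * residue g x)
      = (\<Sum>x\<in>pts. if x \<in> ?I then residue g x else 0)"
  proof (intro sum.cong refl)
    fix x assume "x \<in> pts"
    then have "x \<notin> path_image \<gamma>" "x \<noteq> ?a" using pts(2) a by blast+
    then show "(winding_number \<gamma> x - winding_number (linepath ?a ?a) x) * residue g x
        = (if x \<in> ?I then residue g x else 0)"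
      using wn wn0 by simp
  qed
  also have "\<dots> = (\<Sum>x\<in>pts \<inter> ?I. residue g x)"
    using pts(1) by (simp add: sum.If_cases)
  finally show ?thesis by (simp only: contour_integral_trivial diff_zero)
qed

text \<open>Compare \<open>\<gamma>\<close> with a circle around all poles: the decay of
  \<open>g\<close> bounds the integral over the circle by a multiple of \<open>1 / r\<close>, while
  the residue sum no longer depends on \<open>r\<close>.\<close>

lemma Residue_theorem_ccw_exterior:
  fixes g :: "complex \<Rightarrow> complex" and R C :: real
  assumes c: "ccw_loop_in D \<gamma>"
    and S: "open S" "path_image \<gamma> \<union> outside (path_image \<gamma>) \<subseteq> S"
    and pts: "finite pts" "pts \<inter> path_image \<gamma> = {}"
    and hol: "g holomorphic_on S - pts"
    and bd: "\<And>w. R \<le> norm w \<Longrightarrow> norm (g w) \<le> C / norm w ^ 2"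
  shows "contour_integral \<gamma> g = - (2 * pi * \<i> * (\<Sum>x\<in>pts \<inter> outside (path_image \<gamma>). residue g x))"
proof -
  let ?O = "outside (path_image \<gamma>)"
  \<comment> \<open>\<open>K\<close> is the value of the integral over every large circle; being
    independent of the radius, it must be 0.\<close>
  define K where "K = contour_integral \<gamma> g + 2 * pi * \<i> * (\<Sum>x\<in>pts \<inter> ?O. residue g x)"
  have "bounded (path_image \<gamma> \<union> pts)"
    using ccw_loopD[OF c] pts by (simp add: compact_imp_bounded finite_imp_bounded)
  then obtain R0 where "R0 > 0" and R0: "path_image \<gamma> \<union> pts \<subseteq> ball 0 R0"
    by (metis bounded_subset_ballD)
  have ev: "eventually (\<lambda>r. norm K \<le> \<bar>C\<bar> * 2 * pi / r) at_top"
    using eventually_ge_at_top[of "max R0 (max R 1)"]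
  proof eventually_elim
    case (elim r)
    then have r: "r > 0" "r \<ge> R0" "r \<ge> R" by auto
    let ?\<Gamma> = "circlepath 0 r"
    have im: "path_image ?\<Gamma> = sphere 0 r" using r by simp
    have in\<Gamma>: "inside (path_image ?\<Gamma>) = ball 0 r" using r by (simp only: inside_circlepath)
    have ball: "path_image \<gamma> \<union> pts \<subseteq> ball 0 r"
      using R0 r by (meson order_trans subset_ball)
    have sph: "sphere 0 r \<subseteq> ?O"
    proof -
      have "- ball 0 r \<subseteq> ?O"
        using ball by (intro outside_subset_convex) auto
      then show ?thesis by auto
    qed
    have "contour_integral ?\<Gamma> g - contour_integral \<gamma> g =
      2 * pi * \<i> * (\<Sum>x\<in>pts \<inter> inside (path_image ?\<Gamma>) \<inter> ?O. residue g x)"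
    proof (rule Residue_theorem_ccw_annulus[OF ccw_loop_in_circlepath[OF r(1)] c _ S(1) _ pts(1) _ pts(2) hol])
      show "pts \<inter> path_image ?\<Gamma> = {}"
        using ball unfolding im by (auto simp: subset_iff)
    qed (use S sph ball in\<Gamma> im in auto)
    moreover have "pts \<inter> inside (path_image ?\<Gamma>) \<inter> ?O = pts \<inter> ?O"
      using ball unfolding in\<Gamma> by blast
    ultimately have K: "K = contour_integral ?\<Gamma> g"
      by (simp add: K_def algebra_simps)
    have "g contour_integrable_on ?\<Gamma>"
    proof (rule contour_integrable_holomorphic_simple[OF hol])
      show "open (S - pts)" using S(1) pts(1) by (simp add: open_Diff finite_imp_closed)
      show "path_image ?\<Gamma> \<subseteq> S - pts"
        using sph S(2) ball unfolding im by (auto simp: subset_iff)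
    qed simp
    then have "(g has_contour_integral K) ?\<Gamma>"
      unfolding K by (rule has_contour_integral_integral)
    then have "norm K \<le> (\<bar>C\<bar> / r ^ 2) * (2 * pi * r)"
    proof (rule has_contour_integral_bound_circlepath)
      fix x :: complex assume "norm (x - 0) = r"
      then show "norm (g x) \<le> \<bar>C\<bar> / r ^ 2"
        using r by (intro order_trans[OF bd]) (auto intro!: divide_right_mono)
    qed (use r in auto)
    then show ?case using r by (simp add: power2_eq_square field_simps)
  qed
  have "((\<lambda>r. \<bar>C\<bar> * 2 * pi / r) \<longlongrightarrow> 0) at_top"
    by (intro tendsto_divide_0[OF tendsto_const] filterlim_at_top_imp_at_infinity filterlim_ident)
  from tendsto_lowerbound[OF this ev] have "norm K \<le> 0" by simp
  then have "K = 0" by simp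
  then show ?thesis by (simp add: K_def eq_neg_iff_add_eq_0)
qed

section \<open>Sums of residues over the level sets of a polynomial\<close>

text \<open>Open and closed tubes of a small radius. Integrals are estimated below by bounds on an
  open set around the path; the compact hull provides such bounds.\<close>

lemma compact_subset_open_imp_bounded_nbhd:
  fixes K V :: "'a::heine_borel set"
  assumes "compact K" "K \<noteq> {}" "open V" "K \<subseteq> V"
  obtains U C where "open U" "compact C" "K \<subseteq> U" "U \<subseteq> C" "C \<subseteq> V"
proof -
  obtain e where e: "e > 0" "(\<Union>x\<in>K. cball x e) \<subseteq> V"
    using compact_subset_open_imp_cball_epsilon_subset[OF assms(1,3,4)] by blast
  show thesis
  proof (rule that)
    show "open {x. infdist x K < e}"
      by (intro open_Collect_less continuous_intros)
    show "compact {x. infdist x K \<le> e}"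
      using assms e by (intro compact_infdist_le)
    show "K \<subseteq> {x. infdist x K < e}"
      using e by auto
    show "{x. infdist x K \<le> e} \<subseteq> V"
    proof
      fix x assume "x \<in> {x. infdist x K \<le> e}"
      moreover obtain y where "y \<in> K" "infdist x K = dist x y"
        using infdist_attains_inf[of K x] assms by (auto simp: compact_imp_closed)
      ultimately show "x \<in> V"
        using e(2) by (force simp: dist_commute)
    qed
  qed auto
qed

text \<open>Termwise integration of the geometric series in \<open>t / \<phi> w\<close>, whose ratio
  stays uniformly below 1 near the path.\<close>

lemma contour_integral_geometric_sums:
  assumes "open S" "valid_path \<gamma>" "path_image \<gamma> \<subseteq> S"
    and h: "h holomorphic_on S" and \<phi>: "\<phi> holomorphic_on S"
    and less: "\<And>w. w \<in> path_image \<gamma> \<Longrightarrow> norm t < norm (\<phi> w)"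
  shows "(\<lambda>n. contour_integral \<gamma> (\<lambda>w. h w / \<phi> w ^ Suc n) * t ^ n) sums
    contour_integral \<gamma> (\<lambda>w. h w / (\<phi> w - t))"
proof -
  define K where "K = path_image \<gamma>"
  have K: "compact K" "K \<noteq> {}" "K \<subseteq> S"
    using assms by (auto simp: K_def compact_valid_path_image)
  have "continuous_on K (\<lambda>w. norm (\<phi> w))"
    using \<phi> K by (intro continuous_intros holomorphic_on_imp_continuous_on holomorphic_on_subset[OF \<phi>])
  from continuous_attains_inf[OF K(1,2) this] obtain w0 where
    w0: "w0 \<in> K" "\<And>w. w \<in> K \<Longrightarrow> norm (\<phi> w0) \<le> norm (\<phi> w)" by blast
  \<comment> \<open>A level strictly in between leaves room to pass from the path to a neighbourhood
    while keeping the ratio below \<open>norm t / d < 1\<close>.\<close>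
  obtain d where d: "norm t < d" "d < norm (\<phi> w0)"
    using less w0(1) dense unfolding K_def by blast
  then have "d > 0" by (meson norm_ge_zero order_le_less_trans)
  have "continuous_on S (\<lambda>w. norm (\<phi> w))"
    by (intro continuous_intros holomorphic_on_imp_continuous_on[OF \<phi>])
  then have "open (S \<inter> (\<lambda>w. norm (\<phi> w)) -` {d<..})"
    using \<open>open S\<close> by (intro continuous_open_preimage) auto
  moreover have "K \<subseteq> S \<inter> (\<lambda>w. norm (\<phi> w)) -` {d<..}"
    using K(3) w0 d by force
  ultimately obtain U C where U: "open U" "compact C" "K \<subseteq> U" "U \<subseteq> C"
    and C: "C \<subseteq> S \<inter> (\<lambda>w. norm (\<phi> w)) -` {d<..}"
    by (rule compact_subset_open_imp_bounded_nbhd[OF K(1,2)])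
  have US: "U \<subseteq> S" using U C by blast
  have U\<phi>: "d < norm (\<phi> w)" if "w \<in> U" for w using U C that by blast
  have nz: "\<phi> w \<noteq> 0" "\<phi> w - t \<noteq> 0" if "w \<in> U" for w
    using U\<phi>[OF that] d \<open>d > 0\<close> by auto
  have "continuous_on C h"
    using C by (intro holomorphic_on_imp_continuous_on holomorphic_on_subset[OF h]) blast
  then have "bounded (h ` C)"
    using U(2) compact_continuous_image compact_imp_bounded by blast
  then obtain B where "B > 0" and B: "\<And>w. w \<in> C \<Longrightarrow> norm (h w) \<le> B"
    by (auto simp: bounded_pos)
  obtain L where "L > 0" and L: "\<And>f B. f holomorphic_on U \<Longrightarrow> (\<And>z. z \<in> U \<Longrightarrow> norm (f z) \<le> B)
      \<Longrightarrow> norm (contour_integral \<gamma> f) \<le> L * B"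
    using contour_integral_bound_exists[OF U(1) assms(2)] U(3) unfolding K_def by metis
  have hU: "h holomorphic_on U" and \<phi>U: "\<phi> holomorphic_on U"
    using US h \<phi> holomorphic_on_subset by blast+
  have int: "f contour_integrable_on \<gamma>" if "f holomorphic_on U" for f
    using that U(1,3) assms(2) unfolding K_def by (intro contour_integrable_holomorphic_simple)
  have hol: "(\<lambda>w. h w / \<phi> w ^ Suc n * t ^ n) holomorphic_on U"
      "(\<lambda>w. h w / \<phi> w ^ Suc n) holomorphic_on U"
      "(\<lambda>w. h w / (\<phi> w - t)) holomorphic_on U"
      "(\<lambda>w. t ^ n * h w / (\<phi> w ^ n * (\<phi> w - t))) holomorphic_on U" for n
    using nz by (intro holomorphic_intros hU \<phi>U; simp)+
  let ?I = "contour_integral \<gamma> (\<lambda>w. h w / (\<phi> w - t))"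
  let ?s = "\<lambda>N. \<Sum>n<N. contour_integral \<gamma> (\<lambda>w. h w / \<phi> w ^ Suc n) * t ^ n"
  \<comment> \<open>The tail of the geometric series in closed form; it carries the factor
    \<open>(t / \<phi> w) ^ N\<close>.\<close>
  have diff: "?I - ?s N = contour_integral \<gamma> (\<lambda>w. t ^ N * h w / (\<phi> w ^ N * (\<phi> w - t)))" for N
  proof -
    have ptw: "h w / (\<phi> w - t) - (\<Sum>n<N. h w / \<phi> w ^ Suc n * t ^ n) = t ^ N * h w / (\<phi> w ^ N * (\<phi> w - t))"
      if "w \<in> U" for w
    proof (induction N)
      case (Suc N)
      have "h w / (\<phi> w - t) - (\<Sum>n<Suc N. h w / \<phi> w ^ Suc n * t ^ n)
          = t ^ N * h w / (\<phi> w ^ N * (\<phi> w - t)) - h w / \<phi> w ^ Suc N * t ^ N"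
        unfolding Suc [symmetric] by simp
      also have "\<dots> = t ^ Suc N * h w / (\<phi> w ^ Suc N * (\<phi> w - t))"
        using nz[OF that] by (simp add: divide_simps) (simp add: algebra_simps)
      finally show ?case .
    qed simp
    have "?s N = contour_integral \<gamma> (\<lambda>w. \<Sum>n<N. h w / \<phi> w ^ Suc n * t ^ n)"
      using int hol by (subst contour_integral_sum) (simp_all only: finite_lessThan contour_integral_rmul)
    then have "?I - ?s N = contour_integral \<gamma> (\<lambda>w. h w / (\<phi> w - t) - (\<Sum>n<N. h w / \<phi> w ^ Suc n * t ^ n))"
      using int hol by (subst contour_integral_diff) (auto intro!: contour_integrable_sum simp del: power_Suc)
    also have "\<dots> = contour_integral \<gamma> (\<lambda>w. t ^ N * h w / (\<phi> w ^ N * (\<phi> w - t)))"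
      using ptw U(3) by (intro contour_integral_cong) (auto simp: K_def)
    finally show ?thesis .
  qed
  have "norm (?s N - ?I) \<le> (L * B / (d - norm t)) * (norm t / d) ^ N" for N
  proof -
    have "norm (contour_integral \<gamma> (\<lambda>w. t ^ N * h w / (\<phi> w ^ N * (\<phi> w - t))))
        \<le> L * (norm t ^ N * B / (d ^ N * (d - norm t)))"
    proof (rule L[OF hol(4)])
      fix w assume w: "w \<in> U"
      have "d - norm t \<le> norm (\<phi> w - t)"
        using U\<phi>[OF w] norm_triangle_ineq2[of "\<phi> w" t] by linarith
      moreover have "d ^ N \<le> norm (\<phi> w) ^ N"
        using U\<phi>[OF w] \<open>d > 0\<close> by (intro power_mono) auto
      moreover have "norm (h w) \<le> B" using B w U by blast
      ultimately show "norm (t ^ N * h w / (\<phi> w ^ N * (\<phi> w - t))) \<le> norm t ^ N * B / (d ^ N * (d - norm t))"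
        unfolding norm_divide norm_mult norm_power using d \<open>d > 0\<close> \<open>B > 0\<close>
        by (intro frac_le mult_mono) auto
    qed
    also have "\<dots> = (L * B / (d - norm t)) * (norm t / d) ^ N"
      by (simp add: power_divide mult_ac)
    finally show ?thesis
      unfolding norm_minus_commute[of "?s N"] diff .
  qed
  moreover have "(\<lambda>N. (L * B / (d - norm t)) * (norm t / d) ^ N) \<longlonglongrightarrow> 0"
    using d \<open>d > 0\<close> by (intro tendsto_mult_right_zero LIMSEQ_realpow_zero) auto
  ultimately have "(\<lambda>N. ?s N - ?I) \<longlonglongrightarrow> 0"
    by (intro Lim_null_comparison[of "\<lambda>N. ?s N - ?I"]) auto
  then show ?thesis
    unfolding sums_def by (rule LIM_zero_cancel)
qed

text \<open>The general \<open>\<phi>\<close> covers three uses: the polynomial \<open>P\<close>,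
  its reciprocal, and the identity for Cauchy integrals.\<close>

lemma contour_integral_has_fps_expansion:
  assumes "open S" "valid_path \<gamma>" "path_image \<gamma> \<subseteq> S"
    and h: "h holomorphic_on S" and \<phi>: "\<phi> holomorphic_on S"
    and ne: "\<And>w. w \<in> path_image \<gamma> \<Longrightarrow> \<phi> w \<noteq> a"
  shows "(\<lambda>t. contour_integral \<gamma> (\<lambda>w. h w / (\<phi> w - (a + t)))) has_fps_expansion
    Abs_fps (\<lambda>n. contour_integral \<gamma> (\<lambda>w. h w / (\<phi> w - a) ^ Suc n))"
proof (rule has_fps_expansionI)
  have K: "compact (path_image \<gamma>)" "path_image \<gamma> \<noteq> {}"
    using assms by (auto simp: compact_valid_path_image)
  have "continuous_on (path_image \<gamma>) (\<lambda>w. norm (\<phi> w - a))"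
    using assms(3) by (intro continuous_intros holomorphic_on_imp_continuous_on holomorphic_on_subset[OF \<phi>])
  from continuous_attains_inf[OF K this] obtain w0 where
    w0: "w0 \<in> path_image \<gamma>" "\<And>w. w \<in> path_image \<gamma> \<Longrightarrow> norm (\<phi> w0 - a) \<le> norm (\<phi> w - a)"
    by blast
  have "eventually (\<lambda>t::complex. t \<in> ball 0 (norm (\<phi> w0 - a))) (nhds 0)"
    using ne[OF w0(1)] by (intro eventually_nhds_in_open) auto
  then show "eventually (\<lambda>t. (\<lambda>n. Abs_fps (\<lambda>n. contour_integral \<gamma> (\<lambda>w. h w / (\<phi> w - a) ^ Suc n)) $ n * t ^ n)
      sums contour_integral \<gamma> (\<lambda>w. h w / (\<phi> w - (a + t)))) (nhds 0)"
  proof eventually_elim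
    case (elim t)
    have "(\<lambda>n. contour_integral \<gamma> (\<lambda>w. h w / (\<phi> w - a) ^ Suc n) * t ^ n) sums
      contour_integral \<gamma> (\<lambda>w. h w / ((\<phi> w - a) - t))"
    proof (rule contour_integral_geometric_sums[OF assms(1-4)])
      show "(\<lambda>w. \<phi> w - a) holomorphic_on S"
        by (intro holomorphic_intros \<phi>)
      show "norm t < norm (\<phi> w - a)" if "w \<in> path_image \<gamma>" for w
        using elim w0(2)[OF that] by simp
    qed
    then show ?case by (simp add: diff_diff_eq)
  qed
qed

text \<open>Each of the \<open>degree q\<close> linear factors has modulus at least
  \<open>\<epsilon>\<close> at \<open>w\<close>. Conversely, a small value forces a root nearby,
  which confines the solutions of \<open>P w = t\<close>.\<close>

lemma poly_norm_lower_bound: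
  fixes q :: "complex poly"
  assumes "0 \<le> \<epsilon>" "\<And>x. poly q x = 0 \<Longrightarrow> \<epsilon> \<le> dist x w"
  shows "norm (lead_coeff q) * \<epsilon> ^ degree q \<le> norm (poly q w)"
  using assms(2)
proof (induction "degree q" arbitrary: q)
  case 0
  then obtain c where "q = [:c:]" by (metis degree_eq_zeroE)
  then show ?case by simp
next
  case (Suc n)
  then obtain a where a: "poly q a = 0"
    using alg_closed_imp_poly_has_root[of q] by auto
  then obtain r where r: "q = [:- a, 1:] * r"
    by (auto simp: poly_eq_0_iff_dvd elim: dvdE)
  have "r \<noteq> 0" using Suc.hyps(2) by (auto simp: r)
  then have deg: "degree q = Suc (degree r)"
    unfolding r by (subst degree_mult_eq) auto
  have lc: "lead_coeff q = lead_coeff r"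
    unfolding r lead_coeff_mult by simp
  have "norm (lead_coeff r) * \<epsilon> ^ degree r \<le> norm (poly r w)"
    using Suc.hyps(2) deg by (intro Suc.hyps(1) Suc.prems) (auto simp: r)
  moreover have "\<epsilon> \<le> norm (w - a)"
    using Suc.prems[OF a] by (simp add: dist_norm norm_minus_commute)
  ultimately have "(norm (lead_coeff r) * \<epsilon> ^ degree r) * \<epsilon> \<le> norm (poly r w) * norm (w - a)"
    using assms(1) by (intro mult_mono) auto
  moreover have "poly q w = poly r w * (w - a)"
    by (simp add: r algebra_simps)
  ultimately show ?case
    unfolding lc unfolding deg by (simp add: norm_mult mult_ac)
qed

text \<open>The poles are collected in a set, so coinciding ones are counted once and the residue
  accounts for their order. No contour enters, so the sum stays meaningful when solutions of
  \<open>P w = t\<close> leave a given loop.\<close>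

definition residue_trace :: "complex poly \<Rightarrow> complex \<Rightarrow> (complex \<Rightarrow> complex) \<Rightarrow> complex \<Rightarrow> complex" where
  "residue_trace P z g t =
    (\<Sum>x\<in>insert z {w. poly P w = t}. residue (\<lambda>w. g w / ((w - z) * (poly P w - t))) x)"

lemma finite_poly_level:
  fixes P :: "'a::idom poly"
  assumes "degree P > 0"
  shows "finite {w. poly P w = t}"
proof -
  have "P - [:t:] \<noteq> 0" using assms by auto
  then have "finite {w. poly (P - [:t:]) w = 0}" by (rule poly_roots_finite)
  then show ?thesis by simp
qed

text \<open>
  Near \<open>t0\<close>, the poles at the solutions of \<open>P w = t\<close> stay within small fixed discs around the solutions
  of \<open>P w = t0\<close>, so the sum of residues is a sum of integrals over fixed circles, which depend
  analytically on \<open>t\<close>. Branching of the solutions and the coincidence with the pole \<open>z\<close> do no harm.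
\<close>

lemma residue_trace_analytic:
  assumes deg: "degree P > 0" and U: "open U" "insert z {w. poly P w = t0} \<subseteq> U"
    and g: "g holomorphic_on U"
  shows "residue_trace P z g analytic_on {t0}"
proof -
  define X where "X t = insert z {w. poly P w = t}" for t
  have fin: "finite (X t)" for t
    using deg by (simp add: X_def finite_poly_level)
  have "finite ((\<lambda>(x, y). dist x y) ` (X t0 \<times> X t0) - {0})"
    using fin by auto
  from finite_set_avoid[OF this, of 0] obtain e1 where e1: "e1 > 0"
    "\<forall>v\<in>(\<lambda>(x, y). dist x y) ` (X t0 \<times> X t0) - {0}. v \<noteq> 0 \<longrightarrow> e1 \<le> dist 0 v"
    by blast
  have e1': "e1 \<le> dist x y" if "x \<in> X t0" "y \<in> X t0" "x \<noteq> y" for x y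
  proof -
    have "dist x y \<in> (\<lambda>(x, y). dist x y) ` (X t0 \<times> X t0) - {0}"
      using that by auto
    from bspec[OF e1(2) this] that show ?thesis by (simp add: dist_real_def)
  qed
  obtain e2 where e2: "e2 > 0" "(\<Union>x\<in>X t0. cball x e2) \<subseteq> U"
    using compact_subset_open_imp_cball_epsilon_subset[OF finite_imp_compact[OF fin] U(1)] U(2)
    unfolding X_def by metis
  \<comment> \<open>\<open>e2\<close> keeps the discs inside \<open>U\<close>; half the minimal
    distance \<open>e1\<close> makes them disjoint and keeps each circle at distance at least
    \<open>e\<close> from all centres.\<close>
  define e where "e = min (e1 / 2) e2"
  have e: "e > 0" "e \<le> e1 / 2" "e \<le> e2" using e1 e2 by (auto simp: e_def)
  have cb: "cball x e \<subseteq> U" if "x \<in> X t0" for x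
    using e2 e that by force
  have far: "e \<le> dist y w" if "x \<in> X t0" "y \<in> X t0" "dist x w = e" for x y w
  proof (cases "x = y")
    case False
    then have "e1 \<le> dist x w + dist y w"
      using e1'[OF that(1,2)] dist_triangle2[of x y w] by simp
    then show ?thesis using that e by linarith
  qed (use that in simp)
  have disj: "ball x e \<inter> ball y e = {}" if "x \<in> X t0" "y \<in> X t0" "x \<noteq> y" for x y
  proof -
    have "e1 \<le> dist x y" using e1' that by blast
    then show ?thesis
      using e by (intro disjoint_ballI) auto
  qed
  \<comment> \<open>Outside the discs \<open>poly P w\<close> keeps distance at least
    \<open>d\<close> from \<open>t0\<close>, so for \<open>t\<close> closer than \<open>d\<close> to
    \<open>t0\<close> no solution escapes from the discs.\<close>
  define d where "d = norm (lead_coeff (P - [:t0:])) * e ^ degree (P - [:t0:])"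
  have "P - [:t0:] \<noteq> 0" using deg by auto
  then have "lead_coeff (P - [:t0:]) \<noteq> 0" by (rule leading_coeff_neq_0)
  then have "d > 0"
    unfolding d_def using e by (intro mult_pos_pos zero_less_power) (simp_all only: zero_less_norm_iff not_False_eq_True)
  have low: "d \<le> norm (poly P w - t0)" if "\<And>x. x \<in> X t0 \<Longrightarrow> e \<le> dist x w" for w
  proof -
    have "d \<le> norm (poly (P - [:t0:]) w)"
      unfolding d_def
    proof (rule poly_norm_lower_bound)
      fix x assume "poly (P - [:t0:]) x = 0"
      then show "e \<le> dist x w" by (intro that) (simp add: X_def)
    qed (use e in simp)
    then show ?thesis by simp
  qed
  define G where "G t = (\<Sum>x\<in>X t0. 1 / (2 * pi * \<i>) *
      contour_integral (circlepath x e) (\<lambda>w. g w / (w - z) / (poly P w - t)))" for t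
  have z: "z \<in> X t" for t by (simp add: X_def)
  have "(\<lambda>t. contour_integral (circlepath x e) (\<lambda>w. g w / (w - z) / (poly P w - t))) analytic_on {t0}"
    if x: "x \<in> X t0" for x
  proof (rule has_fps_expansion_imp_analytic, rule contour_integral_has_fps_expansion)
    show "open (U - {z})" using U(1) by auto
    show "path_image (circlepath x e) \<subseteq> U - {z}"
    proof -
      have "sphere x e \<subseteq> U" using cb[OF x] by auto
      moreover have "z \<notin> sphere x e" using far[OF x z, of z] e by auto
      ultimately show ?thesis using e by auto
    qed
    show "(\<lambda>w. g w / (w - z)) holomorphic_on U - {z}"
      by (intro holomorphic_intros holomorphic_on_subset[OF g]) auto
    show "poly P w \<noteq> t0" if "w \<in> path_image (circlepath x e)" for w
    proof -
      have "dist x w = e" using that e by simp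
      then have "d \<le> norm (poly P w - t0)" using far x by (intro low) auto
      then show ?thesis using \<open>d > 0\<close> by auto
    qed
  qed (auto intro: holomorphic_intros)
  then have "G analytic_on {t0}"
    unfolding G_def by (intro analytic_intros)
  moreover have "eventually (\<lambda>t. residue_trace P z g t = G t) (nhds t0)"
  proof -
    have "eventually (\<lambda>t. t \<in> ball t0 d) (nhds t0)"
      using \<open>d > 0\<close> by (intro eventually_nhds_in_open) auto
    then show ?thesis
    proof eventually_elim
      case (elim t)
      define F where "F = (\<lambda>w. g w / ((w - z) * (poly P w - t)))"
      have near: "\<exists>x\<in>X t0. w \<in> ball x e" if "w \<in> X t" for w
      proof (rule ccontr)
        assume "\<not> (\<exists>x\<in>X t0. w \<in> ball x e)"
        then have *: "\<And>x. x \<in> X t0 \<Longrightarrow> e \<le> dist x w" by force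
        then have "w \<noteq> z" using z[of t0] e by force
        then have "poly P w = t" using that by (simp add: X_def)
        with low[OF *] elim show False by (simp add: dist_norm norm_minus_commute)
      qed
      have off: "w \<notin> X t" if "x \<in> X t0" "dist x w = e" for x w
        using near[of w] far[OF that(1) _ that(2)] by force
      have "residue_trace P z g t = (\<Sum>w\<in>X t. residue F w)"
        by (simp add: residue_trace_def X_def F_def)
      also have "X t = (\<Union>x\<in>X t0. X t \<inter> ball x e)"
        using near by blast
      also have "(\<Sum>w\<in>(\<Union>x\<in>X t0. X t \<inter> ball x e). residue F w)
          = (\<Sum>x\<in>X t0. \<Sum>w\<in>X t \<inter> ball x e. residue F w)"
        using fin disj by (intro sum.UNION_disjoint) auto
      also have "\<dots> = G t"
        unfolding G_def
      proof (rule sum.cong[OF refl])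
        fix x assume x: "x \<in> X t0"
        have im: "path_image (circlepath x e) = sphere x e" using e by simp
        have ins: "inside (path_image (circlepath x e)) = ball x e" by (rule inside_circlepath[OF e(1)])
        have "contour_integral (circlepath x e) F =
            2 * pi * \<i> * (\<Sum>w\<in>X t \<inter> inside (path_image (circlepath x e)). residue F w)"
        proof (rule Residue_theorem_ccw_disc[OF ccw_loop_in_circlepath[OF e(1)] U(1) _ fin])
          show "path_image (circlepath x e) \<union> inside (path_image (circlepath x e)) \<subseteq> U"
            unfolding ins unfolding im using cb[OF x] by auto
          show "X t \<inter> path_image (circlepath x e) = {}"
            unfolding im using off[OF x] by auto
          show "F holomorphic_on U - X t"
            unfolding F_def
            by (intro holomorphic_intros holomorphic_on_subset[OF g]) (auto simp: X_def)
        qed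
        then show "(\<Sum>w\<in>X t \<inter> ball x e. residue F w) = 1 / (2 * pi * \<i>) *
            contour_integral (circlepath x e) (\<lambda>w. g w / (w - z) / (poly P w - t))"
          unfolding ins by (simp add: F_def)
      qed
      finally show ?case .
    qed
  qed
  ultimately show ?thesis
    by (subst analytic_at_cong) auto
qed

section \<open>Remainder integrals and Laurent splitting\<close>

text \<open>Far out, \<open>w\<close> has distance at least \<open>norm w / 2\<close> from
  \<open>z\<close> and from all roots of \<open>Q\<close>; one such factor comes from
  \<open>w - z\<close> and at least one from \<open>Q\<close>.\<close>

lemma inverse_square_bound:
  fixes g :: "complex \<Rightarrow> complex"
  assumes deg: "degree Q > 0" and g: "\<And>w. R \<le> norm w \<Longrightarrow> norm (g w) \<le> C"
  obtains R' C' where "\<And>w. R' \<le> norm w \<Longrightarrow> norm (g w / ((w - z) * poly Q w)) \<le> C' / norm w ^ 2"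
proof -
  have "Q \<noteq> 0" using deg by auto
  have "bounded (insert z {x. poly Q x = 0})"
    using poly_roots_finite[OF \<open>Q \<noteq> 0\<close>] by (simp add: finite_imp_bounded)
  then obtain M where M: "\<And>x. x \<in> insert z {x. poly Q x = 0} \<Longrightarrow> norm x \<le> M"
    by (metis bounded_iff)
  define a where "a = norm (lead_coeff Q)"
  have "a > 0" using \<open>Q \<noteq> 0\<close> by (simp add: a_def)
  show thesis
  proof (rule that)
    \<comment> \<open>The constant 2 gives \<open>norm w / 2 \<ge> 1\<close>, so raising it to
      \<open>degree Q\<close> does not make it smaller; \<open>2 * M\<close> gives the distance
      estimate.\<close>
    fix w :: complex assume w: "max R (max 2 (2 * M)) \<le> norm w"
    have dist: "norm w / 2 \<le> dist x w" if "x \<in> insert z {x. poly Q x = 0}" for x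
      using M[OF that] w norm_triangle_ineq2[of w x] by (simp add: dist_norm norm_minus_commute)
    have "a * (norm w / 2) \<le> a * (norm w / 2) ^ degree Q"
      using w \<open>a > 0\<close> deg by (intro mult_left_mono self_le_power) auto
    also have "\<dots> \<le> norm (poly Q w)"
      unfolding a_def using dist by (intro poly_norm_lower_bound) auto
    finally have Q: "a * (norm w / 2) \<le> norm (poly Q w)" .
    have "norm w / 2 \<le> norm (w - z)"
      using dist[of z] by (simp add: dist_norm norm_minus_commute)
    then have "(norm w / 2) * (a * (norm w / 2)) \<le> norm (w - z) * norm (poly Q w)"
      using Q \<open>a > 0\<close> by (intro mult_mono) auto
    then have "norm (g w / ((w - z) * poly Q w)) \<le> \<bar>C\<bar> / ((norm w / 2) * (a * (norm w / 2)))"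
      unfolding norm_divide norm_mult
    proof (intro frac_le)
      show "0 < norm w / 2 * (a * (norm w / 2))"
        using w \<open>a > 0\<close> by (intro mult_pos_pos) auto
      show "norm (g w) \<le> \<bar>C\<bar>" using g[of w] w by simp
    qed auto
    then show "norm (g w / ((w - z) * poly Q w)) \<le> (4 * \<bar>C\<bar> / a) / norm w ^ 2"
      using \<open>a > 0\<close> by (simp add: power2_eq_square field_simps)
  qed
qed

text \<open>For small \<open>t\<close> all poles lie inside \<open>\<gamma>\<close>, and the
  generating function of the integrals is a multiple of \<open>residue_trace\<close>. The latter is
  analytic for \<open>norm t < \<rho>\<close> even where level sets leave the loop, so the series
  converges at \<open>poly P z\<close> and its terms tend to 0.\<close>

lemma inner_remainder_tendsto_0:
  assumes deg: "degree P > 0" and c: "ccw_loop_in D \<gamma>"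
    and \<Omega>: "open \<Omega>" "path_image \<gamma> \<union> inside (path_image \<gamma>) \<subseteq> \<Omega>" and f: "f holomorphic_on \<Omega>"
    and roots: "{w. poly P w = 0} \<subseteq> inside (path_image \<gamma>)" and z: "z \<in> inside (path_image \<gamma>)"
    and level: "{w. norm (poly P w) < \<rho>} \<subseteq> \<Omega>" and Pz: "norm (poly P z) < \<rho>"
  shows "(\<lambda>n. contour_integral \<gamma> (\<lambda>w. f w / ((w - z) * poly P w ^ n)) * poly P z ^ n) \<longlonglongrightarrow> 0"
proof -
  let ?I = "inside (path_image \<gamma>)"
  note c' = ccw_loopD[OF c]
  have disj: "path_image \<gamma> \<inter> ?I = {}" using inside_no_overlap by blast
  define F where "F = Abs_fps (\<lambda>n. contour_integral \<gamma> (\<lambda>w. f w / (w - z) / (poly P w - 0) ^ Suc n))"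
  have exp: "(\<lambda>t. contour_integral \<gamma> (\<lambda>w. f w / (w - z) / (poly P w - (0 + t)))) has_fps_expansion F"
    unfolding F_def
  proof (rule contour_integral_has_fps_expansion)
    show "open (\<Omega> - {z})" using \<Omega> by auto
    show "path_image \<gamma> \<subseteq> \<Omega> - {z}" using \<Omega> disj z by blast
    show "(\<lambda>w. f w / (w - z)) holomorphic_on \<Omega> - {z}"
      by (intro holomorphic_intros holomorphic_on_subset[OF f]) auto
    show "poly P w \<noteq> 0" if "w \<in> path_image \<gamma>" for w using that roots disj by blast
  qed (auto intro: holomorphic_intros c')
  have "P \<noteq> 0" using deg by auto
  obtain e where e: "e > 0" "(\<Union>x\<in>{w. poly P w = 0}. cball x e) \<subseteq> ?I"
    using compact_subset_open_imp_cball_epsilon_subset[OF finite_imp_compact[OF poly_roots_finite[OF \<open>P \<noteq> 0\<close>]] c'(11) roots]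
    by blast
  \<comment> \<open>Points not inside \<open>\<gamma>\<close> are at distance at least
    \<open>e\<close> from every root, so \<open>d\<close> bounds the modulus of \<open>P\<close>
    from below there.\<close>
  define d where "d = norm (lead_coeff P) * e ^ degree P"
  have "d > 0" using \<open>P \<noteq> 0\<close> e by (simp add: d_def)
  have ins: "w \<in> ?I" if "norm (poly P w) < d" for w
  proof (rule ccontr)
    assume "w \<notin> ?I"
    then have "d \<le> norm (poly P w)"
      unfolding d_def using e by (intro poly_norm_lower_bound) force+
    with that show False by simp
  qed
  have "eventually (\<lambda>t. t \<in> ball 0 d) (nhds (0::complex))"
    using \<open>d > 0\<close> by (intro eventually_nhds_in_open) auto
  then have "eventually (\<lambda>t. contour_integral \<gamma> (\<lambda>w. f w / (w - z) / (poly P w - (0 + t))) =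
      2 * pi * \<i> * residue_trace P z f t) (nhds 0)"
  proof eventually_elim
    case (elim t)
    let ?X = "insert z {w. poly P w = t}" and ?g = "\<lambda>w. f w / ((w - z) * (poly P w - t))"
    have X: "?X \<subseteq> ?I" using ins elim z by auto
    have "contour_integral \<gamma> ?g = 2 * pi * \<i> * (\<Sum>x\<in>?X \<inter> ?I. residue ?g x)"
    proof (rule Residue_theorem_ccw_disc[OF c \<Omega>])
      show "finite ?X" using finite_poly_level[OF deg] by simp
      show "?X \<inter> path_image \<gamma> = {}" using X disj by blast
      show "?g holomorphic_on \<Omega> - ?X"
        by (intro holomorphic_intros holomorphic_on_subset[OF f]) auto
    qed
    also have "?X \<inter> ?I = ?X" using X by blast
    finally show ?case by (simp add: residue_trace_def)
  qed
  with exp have "(\<lambda>t. 2 * pi * \<i> * residue_trace P z f t) has_fps_expansion F"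
    unfolding has_fps_expansion_def by (auto elim: eventually_elim2)
  moreover have "(\<lambda>t. 2 * pi * \<i> * residue_trace P z f t) holomorphic_on eball 0 (ereal \<rho>)"
  proof -
    have "residue_trace P z f analytic_on {t}" if "norm t < \<rho>" for t
      using level that z \<Omega> by (intro residue_trace_analytic[OF deg \<Omega>(1) _ f]) auto
    then have "residue_trace P z f analytic_on ball 0 \<rho>"
      by (subst analytic_on_analytic_at) auto
    then show ?thesis
      by (intro holomorphic_intros) (auto intro: analytic_imp_holomorphic)
  qed
  moreover have "ereal (norm (poly P z)) < ereal \<rho>" using Pz by simp
  ultimately have "(\<lambda>n. fps_nth F n * poly P z ^ n) sums (2 * pi * \<i> * residue_trace P z f (poly P z))"
    by (rule has_fps_expansion_imp_sums_complex)
  \<comment> \<open>Coefficient \<open>n\<close> of \<open>F\<close> belongs to the power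
    \<open>n + 1\<close>, hence the additional factor and the final index shift.\<close>
  then have "(\<lambda>n. fps_nth F n * poly P z ^ n * poly P z) \<longlonglongrightarrow> 0"
    by (intro tendsto_mult_left_zero summable_LIMSEQ_zero) (rule sums_summable)
  then have "(\<lambda>n. contour_integral \<gamma> (\<lambda>w. f w / ((w - z) * poly P w ^ Suc n)) * poly P z ^ Suc n) \<longlonglongrightarrow> 0"
    by (simp add: F_def mult_ac)
  then show ?thesis by (rule LIMSEQ_imp_Suc)
qed

text \<open>The mirror image in the variable \<open>s = 1 / t\<close>, with \<open>1 / P\<close> for
  \<open>P\<close>. For small \<open>s\<close> the solutions of \<open>P w = t\<close> lie outside
  \<open>\<gamma>\<close>, and the boundedness of \<open>f\<close> gives the decay for the exterior
  residue theorem.\<close>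

lemma outer_remainder_tendsto_0:
  assumes deg: "degree P > 0" and c: "ccw_loop_in D \<gamma>"
    and V: "open V" "path_image \<gamma> \<union> outside (path_image \<gamma>) \<subseteq> V" and f: "f holomorphic_on V"
    and bd: "\<And>w. R \<le> norm w \<Longrightarrow> norm (f w) \<le> C"
    and roots: "{w. poly P w = 0} \<subseteq> inside (path_image \<gamma>)" and z: "z \<in> outside (path_image \<gamma>)"
    and level: "{w. norm (poly P w) > \<rho>} \<subseteq> V" and Pz: "norm (poly P z) > \<rho>" and "\<rho> > 0"
  shows "(\<lambda>n. contour_integral \<gamma> (\<lambda>w. poly P w ^ n * (f w / (w - z))) * (1 / poly P z ^ n)) \<longlonglongrightarrow> 0"
proof -
  let ?I = "inside (path_image \<gamma>)" and ?O = "outside (path_image \<gamma>)"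
  note c' = ccw_loopD[OF c]
  have disj: "path_image \<gamma> \<inter> ?I = {}" "path_image \<gamma> \<inter> ?O = {}"
    using inside_no_overlap outside_no_overlap by blast+
  have Pnz: "poly P w \<noteq> 0" if "w \<in> path_image \<gamma>" for w
    using that roots disj by blast
  have znz: "w \<noteq> z" if "w \<in> path_image \<gamma>" for w
    using that z disj by blast
  \<comment> \<open>The division by \<open>poly P w\<close> in \<open>h\<close> turns
    \<open>h w / \<phi> w ^ Suc n\<close> into the integrand with exponent \<open>n\<close>, so no
    index shift arises here.\<close>
  define h where "h = (\<lambda>w. f w / (w - z) / poly P w)"
  define \<phi> where "\<phi> = (\<lambda>w. 1 / poly P w)"
  define F where "F = Abs_fps (\<lambda>n. contour_integral \<gamma> (\<lambda>w. h w / (\<phi> w - 0) ^ Suc n))"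
  define I where "I s = contour_integral \<gamma> (\<lambda>w. h w / (\<phi> w - (0 + s)))" for s
  have exp: "I has_fps_expansion F"
    unfolding F_def I_def
  proof (rule contour_integral_has_fps_expansion)
    have "P \<noteq> 0" using deg by auto
    then show "open (V - insert z {w. poly P w = 0})"
      using V poly_roots_finite by (intro open_Diff finite_imp_closed) auto
    show "path_image \<gamma> \<subseteq> V - insert z {w. poly P w = 0}"
      using V Pnz znz by blast
    show "h holomorphic_on V - insert z {w. poly P w = 0}"
      unfolding h_def by (intro holomorphic_intros holomorphic_on_subset[OF f]) auto
    show "\<phi> holomorphic_on V - insert z {w. poly P w = 0}"
      unfolding \<phi>_def by (intro holomorphic_intros) auto
    show "\<phi> w \<noteq> 0" if "w \<in> path_image \<gamma>" for w
      using Pnz[OF that] by (simp add: \<phi>_def)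
  qed (rule c')
  have F: "fps_nth F n = contour_integral \<gamma> (\<lambda>w. poly P w ^ n * (f w / (w - z)))" for n
    unfolding F_def h_def \<phi>_def fps_nth_Abs_fps
    by (intro contour_integral_cong refl) (use Pnz znz in \<open>simp add: field_simps\<close>)
  \<comment> \<open>The level \<open>1 / s\<close> has no meaning at 0, so \<open>T\<close> takes
    the value of the integral there. Analyticity at 0 comes from the power series, elsewhere from
    the residue sum.\<close>
  define T where "T s = (if s = 0 then I 0 else 2 * pi * \<i> * (1 / s * residue_trace P z f (1 / s)))" for s
  have "compact (path_image \<gamma> \<union> ?I)"
    using c' by (simp add: compact_eq_bounded_closed closed_path_image_Un_inside bounded_inside)
  then have "bounded (poly P ` (path_image \<gamma> \<union> ?I))"
    by (intro compact_imp_bounded compact_continuous_image) (auto intro: continuous_intros)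
  then obtain M where "M > 0" and M: "\<And>w. w \<in> path_image \<gamma> \<union> ?I \<Longrightarrow> norm (poly P w) \<le> M"
    by (auto simp: bounded_pos)
  have out: "w \<in> ?O" if "norm (poly P w) > M" for w
    using M[of w] that by (metis ComplI not_le union_with_inside)
  have "eventually (\<lambda>s. s \<in> ball 0 (1 / M)) (nhds (0::complex))"
    using \<open>M > 0\<close> by (intro eventually_nhds_in_open) auto
  then have IT: "eventually (\<lambda>s. I s = T s) (nhds 0)"
  proof eventually_elim
    case (elim s)
    show ?case
    proof (cases "s = 0")
      case False
      define t where "t = 1 / s"
      have "norm t > M"
        using elim \<open>M > 0\<close> False by (simp add: t_def norm_divide field_simps)
      let ?X = "insert z {w. poly P w = t}" and ?g = "\<lambda>w. f w / ((w - z) * (poly P w - t))"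
      have X: "?X \<subseteq> ?O" using out \<open>norm t > M\<close> z by auto
      have "P - [:t:] = P + [:- t:]" by simp
      then have "degree (P - [:t:]) = degree P"
        using degree_add_eq_left[of "[:- t:]" P] deg by (simp only: degree_pCons_0)
      then obtain R' C' where R': "\<And>w. R' \<le> norm w \<Longrightarrow> norm (?g w) \<le> C' / norm w ^ 2"
        using inverse_square_bound[of "P - [:t:]" R f C z] deg bd by auto
      have "contour_integral \<gamma> ?g = - (2 * pi * \<i> * (\<Sum>x\<in>?X \<inter> ?O. residue ?g x))"
      proof (rule Residue_theorem_ccw_exterior[OF c V _ _ _ R'])
        show "finite ?X" using finite_poly_level[OF deg] by simp
        show "?X \<inter> path_image \<gamma> = {}" using X disj by blast
        show "?g holomorphic_on V - ?X"
          by (intro holomorphic_intros holomorphic_on_subset[OF f]) auto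
      qed
      also have "?X \<inter> ?O = ?X" using X by blast
      finally have g: "contour_integral \<gamma> ?g = - (2 * pi * \<i> * residue_trace P z f t)"
        by (simp add: residue_trace_def)
      have Pt: "poly P w \<noteq> t" if "w \<in> path_image \<gamma>" for w
        using X that disj by blast
      \<comment> \<open>The factor \<open>- t\<close> comes from
        \<open>1 / (1 / P - 1 / t) = t * P / (t - P)\<close>; its sign cancels that of the exterior
        residue theorem.\<close>
      have "I s = contour_integral \<gamma> (\<lambda>w. - t * ?g w)"
        unfolding I_def
      proof (intro contour_integral_cong refl)
        fix w assume w: "w \<in> path_image \<gamma>"
        have t: "t \<noteq> 0" "s = 1 / t" using False by (auto simp: t_def)
        define u v where "u = w - z" and "v = t - poly P w"
        have uv: "u \<noteq> 0" "v \<noteq> 0"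
          using Pt[OF w] znz[OF w] by (auto simp: u_def v_def)
        have "\<phi> w - (0 + s) = v / (t * poly P w)"
          using t Pnz[OF w] by (simp add: \<phi>_def v_def field_simps)
        moreover have "(w - z) * (poly P w - t) = - (u * v)"
          by (simp add: u_def v_def algebra_simps)
        ultimately show "h w / (\<phi> w - (0 + s)) = - t * ?g w"
          using uv t(1) Pnz[OF w] by (simp add: h_def u_def [symmetric])
      qed
      also have "\<dots> = - t * contour_integral \<gamma> ?g"
      proof (rule contour_integral_lmul, rule contour_integrable_holomorphic_simple)
        show "?g holomorphic_on V - ?X"
          by (intro holomorphic_intros holomorphic_on_subset[OF f]) auto
        show "open (V - ?X)"
          using V finite_poly_level[OF deg] by (intro open_Diff finite_imp_closed) auto
        show "path_image \<gamma> \<subseteq> V - ?X" using V X disj by blast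
      qed (rule c')
      also have "\<dots> = T s"
        using False unfolding g by (simp add: T_def t_def)
      finally show ?thesis .
    qed (simp add: T_def)
  qed
  with exp have expT: "T has_fps_expansion F"
    unfolding has_fps_expansion_def by (auto elim: eventually_elim2)
  have "T analytic_on {s}" if "norm s < 1 / \<rho>" for s
  proof (cases "s = 0")
    case True
    then show ?thesis using expT has_fps_expansion_imp_analytic_0 by simp
  next
    case False
    have "\<rho> < norm (1 / s)"
      using False that \<open>\<rho> > 0\<close> by (simp add: norm_divide field_simps)
    then have "residue_trace P z f analytic_on {1 / s}"
      using level z V by (intro residue_trace_analytic[OF deg V(1) _ f]) auto
    then have "(\<lambda>s. 2 * pi * \<i> * (1 / s * residue_trace P z f (1 / s))) analytic_on {s}"
      using False by (intro analytic_intros analytic_on_compose_gen[of "\<lambda>s. 1 / s" _ "residue_trace P z f" "{1 / s}", unfolded o_def]) auto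
    moreover have "eventually (\<lambda>s. s \<in> - {0}) (nhds s)"
      using False by (intro eventually_nhds_in_open) auto
    then have "eventually (\<lambda>s. T s = 2 * pi * \<i> * (1 / s * residue_trace P z f (1 / s))) (nhds s)"
      by eventually_elim (simp add: T_def)
    ultimately show ?thesis by (subst analytic_at_cong) auto
  qed
  then have "T analytic_on ball 0 (1 / \<rho>)"
    by (subst analytic_on_analytic_at) auto
  then have "T holomorphic_on eball 0 (ereal (1 / \<rho>))"
    by (simp add: analytic_imp_holomorphic)
  moreover have "ereal (norm (1 / poly P z)) < ereal (1 / \<rho>)"
  proof -
    have "norm (poly P z) > 0" using Pz \<open>\<rho> > 0\<close> by linarith
    then show ?thesis using Pz \<open>\<rho> > 0\<close> by (simp add: norm_divide field_simps)
  qed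
  ultimately have "(\<lambda>n. fps_nth F n * (1 / poly P z) ^ n) sums T (1 / poly P z)"
    using expT by (intro has_fps_expansion_imp_sums_complex)
  then have "(\<lambda>n. fps_nth F n * (1 / poly P z) ^ n) \<longlonglongrightarrow> 0"
    by (intro summable_LIMSEQ_zero) (rule sums_summable)
  then show ?thesis
    by (simp add: F power_divide)
qed

section \<open>Cauchy integrals over the two loops\<close>

lemma Cauchy_formula_ccw_annulus:
  assumes c1: "ccw_loop_in D1 \<gamma>1" and c2: "ccw_loop_in D2 \<gamma>2"
    and enc: "path_image \<gamma>2 \<subseteq> inside (path_image \<gamma>1)"
    and S: "open S" "path_image \<gamma>1 \<union> path_image \<gamma>2 \<union> inside (path_image \<gamma>1) \<inter> outside (path_image \<gamma>2) \<subseteq> S"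
    and f: "f holomorphic_on S" and z: "z \<in> inside (path_image \<gamma>1)" "z \<in> outside (path_image \<gamma>2)"
  shows "f z = 1 / (2 * pi * \<i>) * contour_integral \<gamma>1 (\<lambda>w. f w / (w - z))
    - 1 / (2 * pi * \<i>) * contour_integral \<gamma>2 (\<lambda>w. f w / (w - z))"
proof -
  have "contour_integral \<gamma>1 (\<lambda>w. f w / (w - z)) - contour_integral \<gamma>2 (\<lambda>w. f w / (w - z)) =
    2 * pi * \<i> * (\<Sum>x\<in>{z} \<inter> inside (path_image \<gamma>1) \<inter> outside (path_image \<gamma>2). residue (\<lambda>w. f w / (w - z)) x)"
  proof (rule Residue_theorem_ccw_annulus[OF c1 c2 enc S])
    show "{z} \<inter> path_image \<gamma>1 = {}" "{z} \<inter> path_image \<gamma>2 = {}"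
      using z inside_no_overlap outside_no_overlap by blast+
    show "(\<lambda>w. f w / (w - z)) holomorphic_on S - {z}"
      by (intro holomorphic_intros holomorphic_on_subset[OF f]) auto
  qed simp
  also have "{z} \<inter> inside (path_image \<gamma>1) \<inter> outside (path_image \<gamma>2) = {z}"
    using z by blast
  also have "(\<Sum>x\<in>{z}. residue (\<lambda>w. f w / (w - z)) x) = f z"
    using residue_simple[OF S(1) _ f, of z] z S(2) by auto
  finally show ?thesis
    by (simp add: diff_divide_distrib [symmetric])
qed

lemma Cauchy_integral_analytic:
  assumes "open S" "valid_path \<gamma>" "path_image \<gamma> \<subseteq> S" "f holomorphic_on S" "z \<notin> path_image \<gamma>"
  shows "(\<lambda>z. 1 / (2 * pi * \<i>) * contour_integral \<gamma> (\<lambda>w. f w / (w - z))) analytic_on {z}"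
proof (intro analytic_intros)
  have "(\<lambda>t. contour_integral \<gamma> (\<lambda>w. f w / (w - (z + t)))) has_fps_expansion
      Abs_fps (\<lambda>n. contour_integral \<gamma> (\<lambda>w. f w / (w - z) ^ Suc n))"
    using assms by (intro contour_integral_has_fps_expansion[of S]) auto
  then show "(\<lambda>z. contour_integral \<gamma> (\<lambda>w. f w / (w - z))) analytic_on {z}"
    by (rule has_fps_expansion_imp_analytic)
qed

lemma Cauchy_integral_bounded:
  assumes "open S" "valid_path \<gamma>" "path_image \<gamma> \<subseteq> S" "f holomorphic_on S"
  obtains R C where "\<And>z. R \<le> norm z \<Longrightarrow> norm (contour_integral \<gamma> (\<lambda>w. f w / (w - z))) \<le> C"
proof -
  have "compact (path_image \<gamma>)" "path_image \<gamma> \<noteq> {}"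
    using assms by (auto simp: compact_valid_path_image)
  then obtain U K where U: "open U" "compact K" "path_image \<gamma> \<subseteq> U" "U \<subseteq> K" "K \<subseteq> S"
    using compact_subset_open_imp_bounded_nbhd[OF _ _ assms(1,3)] by metis
  have "continuous_on K f"
    using U assms holomorphic_on_imp_continuous_on holomorphic_on_subset by blast
  then have "bounded (f ` K)" "bounded K"
    using U compact_continuous_image compact_imp_bounded by blast+
  then obtain B M where "B > 0" and B: "\<And>w. w \<in> K \<Longrightarrow> norm (f w) \<le> B" and M: "\<And>w. w \<in> K \<Longrightarrow> norm w \<le> M"
    by (auto simp: bounded_pos)
  obtain L where "L > 0" and L: "\<And>f B. f holomorphic_on U \<Longrightarrow> (\<And>z. z \<in> U \<Longrightarrow> norm (f z) \<le> B)
      \<Longrightarrow> norm (contour_integral \<gamma> f) \<le> L * B"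
    using contour_integral_bound_exists[OF U(1) assms(2)] U(3) by metis
  show thesis
  proof (rule that)
    fix z :: complex assume z: "M + 1 \<le> norm z"
    have far: "1 \<le> norm (w - z)" if "w \<in> U" for w
    proof -
      have "norm w \<le> M" using M that U by blast
      then show ?thesis using z norm_triangle_ineq2[of z w] by (simp add: norm_minus_commute)
    qed
    show "norm (contour_integral \<gamma> (\<lambda>w. f w / (w - z))) \<le> L * B"
    proof (rule L)
      have "f holomorphic_on U" using assms U by (meson holomorphic_on_subset order_trans)
      then show "(\<lambda>w. f w / (w - z)) holomorphic_on U"
        using far by (intro holomorphic_intros) force+
      fix w assume w: "w \<in> U"
      then have "norm (f w) / norm (w - z) \<le> B / 1"
        using B U far \<open>B > 0\<close> by (intro frac_le) auto
      then show "norm (f w / (w - z)) \<le> B" by (simp add: norm_divide)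
    qed
  qed
qed

text \<open>Between the loops, Cauchy's formula gives \<open>f = J1 - J2\<close>. \<open>J1\<close>
  is analytic inside \<open>\<gamma>1\<close> and continues beyond it as \<open>f + J2\<close>;
  \<open>- J2\<close> is analytic outside \<open>\<gamma>2\<close>, bounded near infinity, and
  continues inward as \<open>f - J1\<close>. The same formula makes the branches agree on
  overlaps.\<close>

lemma Laurent_splitting:
  assumes \<Omega>: "open \<Omega>" "closed \<Omega>0" and f: "f holomorphic_on \<Omega> - \<Omega>0"
    and c1: "ccw_loop_in (\<Omega> - \<Omega>0) \<gamma>1" and c2: "ccw_loop_in (\<Omega> - \<Omega>0) \<gamma>2"
    and enc: "path_image \<gamma>2 \<subseteq> inside (path_image \<gamma>1)" "\<Omega>0 \<subseteq> inside (path_image \<gamma>2)"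
    and ins: "inside (path_image \<gamma>1) \<subseteq> \<Omega>"
  obtains f1 f2 R C where "f1 holomorphic_on \<Omega>" "f2 holomorphic_on - \<Omega>0"
    "\<And>w. R \<le> norm w \<Longrightarrow> norm (f2 w) \<le> C"
    "\<And>w. w \<in> path_image \<gamma>1 \<union> path_image \<gamma>2 \<Longrightarrow> f w = f1 w + f2 w"
proof -
  let ?I1 = "inside (path_image \<gamma>1)" and ?O1 = "outside (path_image \<gamma>1)"
  let ?I2 = "inside (path_image \<gamma>2)" and ?O2 = "outside (path_image \<gamma>2)"
  let ?S = "\<Omega> - \<Omega>0"
  note c1' = ccw_loopD[OF c1] and c2' = ccw_loopD[OF c2]
  have S: "open ?S" using \<Omega> by (rule open_Diff)
  have sub: "?I2 \<subseteq> ?I1"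
    using c1' c2' enc by (intro inside_inside_compact_connected) (auto intro: compact_imp_closed)
  have cases: "w \<in> ?I1 \<or> w \<in> ?O2" for w
    using enc(1) sub union_with_inside[of "path_image \<gamma>2"] by blast
  have dis: "w \<notin> ?I1" if "w \<in> path_image \<gamma>1" for w
    using that inside_no_overlap by blast
  have dis2: "w \<notin> ?O2" if "w \<in> path_image \<gamma>2 \<or> w \<in> ?I2" for w
    using that outside_no_overlap inside_Int_outside by blast
  define J1 where "J1 z = 1 / (2 * pi * \<i>) * contour_integral \<gamma>1 (\<lambda>w. f w / (w - z))" for z
  define J2 where "J2 z = 1 / (2 * pi * \<i>) * contour_integral \<gamma>2 (\<lambda>w. f w / (w - z))" for z
  have J1: "J1 analytic_on {z}" if "z \<in> ?I1" for z
    unfolding J1_def using that dis by (intro Cauchy_integral_analytic[OF S _ _ f] c1') blast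
  have J2: "J2 analytic_on {z}" if "z \<in> ?O2" for z
    unfolding J2_def using that dis2 by (intro Cauchy_integral_analytic[OF S _ _ f] c2') blast
  have fJ: "f z = J1 z - J2 z" if "z \<in> ?I1" "z \<in> ?O2" for z
    unfolding J1_def J2_def
  proof (rule Cauchy_formula_ccw_annulus[OF c1 c2 enc(1) S _ f that])
    show "path_image \<gamma>1 \<union> path_image \<gamma>2 \<union> ?I1 \<inter> ?O2 \<subseteq> ?S"
      using c1'(5) c2'(5) ins enc(2) dis2 by blast
  qed
  have fan: "f analytic_on {w}" if "w \<in> ?S" for w
    using that S f by (meson analytic_at)
  define f1 where "f1 z = (if z \<in> ?I1 then J1 z else f z + J2 z)" for z
  define f2 where "f2 z = (if z \<in> ?O2 then - J2 z else f z - J1 z)" for z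
  have "f1 analytic_on {z}" if z: "z \<in> \<Omega>" for z
  proof (cases "z \<in> ?I1")
    case True
    then have "eventually (\<lambda>w. w \<in> ?I1) (nhds z)"
      using c1' by (intro eventually_nhds_in_open)
    then have "eventually (\<lambda>w. f1 w = J1 w) (nhds z)"
      by eventually_elim (simp add: f1_def)
    then show ?thesis using J1[OF True] by (subst analytic_at_cong) auto
  next
    case False
    \<comment> \<open>A point of \<open>\<Omega>\<close> not inside \<open>\<gamma>1\<close> lies
      outside \<open>\<gamma>2\<close> and off \<open>\<Omega>0\<close>, so both \<open>f\<close>
      and \<open>J2\<close> are analytic there.\<close>
    then have z': "z \<in> ?O2" "z \<in> ?S" using cases z enc(2) sub by blast+
    then have "eventually (\<lambda>w. w \<in> ?O2) (nhds z)"
      using c2' by (intro eventually_nhds_in_open)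
    then have "eventually (\<lambda>w. f1 w = f w + J2 w) (nhds z)"
      by eventually_elim (use fJ in \<open>simp add: f1_def\<close>)
    moreover have "(\<lambda>w. f w + J2 w) analytic_on {z}"
      using fan J2 z' by (intro analytic_intros)
    ultimately show ?thesis by (subst analytic_at_cong) auto
  qed
  then have "f1 analytic_on \<Omega>"
    by (subst analytic_on_analytic_at) auto
  have "f2 analytic_on {z}" if z: "z \<in> - \<Omega>0" for z
  proof (cases "z \<in> ?O2")
    case True
    then have "eventually (\<lambda>w. w \<in> ?O2) (nhds z)"
      using c2' by (intro eventually_nhds_in_open)
    then have "eventually (\<lambda>w. f2 w = - J2 w) (nhds z)"
      by eventually_elim (simp add: f2_def)
    moreover have "(\<lambda>w. - J2 w) analytic_on {z}"
      using J2[OF True] by (intro analytic_intros)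
    ultimately show ?thesis by (subst analytic_at_cong) auto
  next
    case False
    then have z': "z \<in> ?I1" "z \<in> ?S" using cases z ins by blast+
    then have "eventually (\<lambda>w. w \<in> ?I1) (nhds z)"
      using c1' by (intro eventually_nhds_in_open)
    then have "eventually (\<lambda>w. f2 w = f w - J1 w) (nhds z)"
      by eventually_elim (use fJ in \<open>simp add: f2_def\<close>)
    moreover have "(\<lambda>w. f w - J1 w) analytic_on {z}"
      using fan J1 z' by (intro analytic_intros)
    ultimately show ?thesis by (subst analytic_at_cong) auto
  qed
  then have "f2 analytic_on - \<Omega>0"
    by (subst analytic_on_analytic_at) auto
  obtain R C where RC: "\<And>z. R \<le> norm z \<Longrightarrow> norm (contour_integral \<gamma>2 (\<lambda>w. f w / (w - z))) \<le> C"
    using Cauchy_integral_bounded[OF S c2'(1,5) f] by blast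
  have "bounded (- ?O2)"
    using c2' by (simp flip: union_with_inside add: compact_imp_bounded bounded_inside)
  then obtain M where M: "\<And>w. w \<in> - ?O2 \<Longrightarrow> norm w \<le> M"
    by (metis bounded_iff)
  show thesis
  proof (rule that[of f1 f2 "max R (M + 1)" "C / (2 * pi)"])
    fix w :: complex assume w: "max R (M + 1) \<le> norm w"
    then have "w \<in> ?O2" using M[of w] by force
    then show "norm (f2 w) \<le> C / (2 * pi)"
      using RC[of w] w by (simp add: f2_def J2_def norm_mult norm_divide divide_right_mono)
  next
    fix w assume "w \<in> path_image \<gamma>1 \<union> path_image \<gamma>2"
    then show "f w = f1 w + f2 w"
      using dis dis2 enc(1) cases[of w] by (auto simp: f1_def f2_def)
  next
    show "f1 holomorphic_on \<Omega>" "f2 holomorphic_on - \<Omega>0"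
      using \<open>f1 analytic_on \<Omega>\<close> \<open>f2 analytic_on - \<Omega>0\<close> by (auto intro: analytic_imp_holomorphic)
  qed
qed

section \<open>The multipoint Laurent expansion\<close>

text \<open>The weights \<open>\<kappa>\<close> do not depend on \<open>c\<close>: evaluation at
  \<open>z\<close> is a linear form in the data and so commutes with scalar factors and contour
  integrals.\<close>

lemma poly_multipoint_poly_expand:
  "\<exists>\<kappa>. \<forall>c. poly (multipoint_poly p zs m c) z = (\<Sum>j=1..p. \<Sum>l<m j. c j l * \<kappa> j l)"
proof (intro exI allI)
  fix c
  show "poly (multipoint_poly p zs m c) z = (\<Sum>j=1..p. \<Sum>l<m j. c j l *
      (poly (smult (1 / (\<Prod>k\<in>{1..p} - {j}. (zs j - zs k) ^ m k))
          (\<Prod>k\<in>{1..p} - {j}. [:- zs k, 1:] ^ m k)) z * (z - zs j) ^ l *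
        poly (\<Sum>s<m j - l. smult (hermite_weight p zs m j s) ([:- zs j, 1:] ^ s)) z))"
    unfolding multipoint_poly_def poly_sum poly_mult sum_distrib_left
    by (intro sum.cong refl) (simp add: mult_ac)
qed

lemma poly_multipoint_poly_cmult:
  "poly (multipoint_poly p zs m (\<lambda>j l. a * c j l)) z = a * poly (multipoint_poly p zs m c) z"
proof -
  obtain \<kappa> where "\<And>c. poly (multipoint_poly p zs m c) z = (\<Sum>j=1..p. \<Sum>l<m j. c j l * \<kappa> j l)"
    using poly_multipoint_poly_expand by blast
  then show ?thesis by (simp add: sum_distrib_left mult_ac)
qed

lemma poly_multipoint_poly_contour_integral:
  assumes "\<And>j l. j \<in> {1..p} \<Longrightarrow> h j l contour_integrable_on \<gamma>"
  shows "poly (multipoint_poly p zs m (\<lambda>j l. contour_integral \<gamma> (h j l))) z =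
    contour_integral \<gamma> (\<lambda>w. poly (multipoint_poly p zs m (\<lambda>j l. h j l w)) z)"
proof -
  obtain \<kappa> where \<kappa>: "\<And>c. poly (multipoint_poly p zs m c) z = (\<Sum>j=1..p. \<Sum>l<m j. c j l * \<kappa> j l)"
    using poly_multipoint_poly_expand by blast
  have "((\<lambda>w. \<Sum>j=1..p. \<Sum>l<m j. h j l w * \<kappa> j l) has_contour_integral
      (\<Sum>j=1..p. \<Sum>l<m j. contour_integral \<gamma> (h j l) * \<kappa> j l)) \<gamma>"
    using assms by (intro has_contour_integral_sum has_contour_integral_rmul has_contour_integral_integral) auto
  from contour_integral_unique[OF this] show ?thesis by (simp add: \<kappa>)
qed

text \<open>By linearity the interpolation moves under the integral, where
  \<open>multipoint_poly_kernel\<close> applies at each \<open>w\<close>. Suitable \<open>g\<close>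
  turn this into the recursions for \<open>laurent_q\<close> and \<open>laurent_t\<close>.\<close>

lemma poly_multipoint_poly_Cauchy_integral:
  assumes inj: "inj_on zs {1..p}" and pos: "(\<Sum>k=1..p. m k) > 0"
    and S: "open S" "valid_path \<gamma>" "path_image \<gamma> \<subseteq> S" and g: "g holomorphic_on S"
    and zs: "path_image \<gamma> \<inter> zs ` {1..p} = {}" and z: "z \<notin> path_image \<gamma>"
    and P: "\<And>w. P w = (\<Prod>k=1..p. (w - zs k) ^ m k)"
  shows "poly (multipoint_poly p zs m (\<lambda>j l. contour_integral \<gamma> (\<lambda>w. g w / (w - zs j) ^ (l + 1)))) z =
    contour_integral \<gamma> (\<lambda>w. g w / (w - z)) - P z * contour_integral \<gamma> (\<lambda>w. g w / ((w - z) * P w))"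
proof -
  let ?S = "S - insert z (zs ` {1..p})"
  have S': "open ?S" using S by (intro open_Diff finite_imp_closed) auto
  have im: "path_image \<gamma> \<subseteq> ?S" using S zs z by blast
  have Pnz: "P w \<noteq> 0" if "w \<notin> zs ` {1..p}" for w
    using that by (auto simp: P)
  have "P holomorphic_on UNIV"
    unfolding P [abs_def] by (intro holomorphic_intros)
  then have P': "P holomorphic_on ?S" by (rule holomorphic_on_subset) simp
  have int: "h contour_integrable_on \<gamma>" if "h holomorphic_on ?S" for h
    using contour_integrable_holomorphic_simple[OF that S' S(2) im] .
  have g': "g holomorphic_on ?S" using g by (rule holomorphic_on_subset) auto
  have "poly (multipoint_poly p zs m (\<lambda>j l. contour_integral \<gamma> (\<lambda>w. g w / (w - zs j) ^ (l + 1)))) z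
      = contour_integral \<gamma> (\<lambda>w. poly (multipoint_poly p zs m (\<lambda>j l. g w / (w - zs j) ^ (l + 1))) z)"
  proof (rule poly_multipoint_poly_contour_integral, rule int)
    fix j l assume "j \<in> {1..p}"
    then show "(\<lambda>w. g w / (w - zs j) ^ (l + 1)) holomorphic_on ?S"
      by (intro holomorphic_intros g') auto
  qed
  also have "\<dots> = contour_integral \<gamma> (\<lambda>w. g w / (w - z) - P z * (g w / ((w - z) * P w)))"
  proof (intro contour_integral_cong refl)
    fix w assume "w \<in> path_image \<gamma>"
    then have w: "w \<notin> zs ` {1..p}" "w \<noteq> z" using im by auto
    have "poly (multipoint_poly p zs m (\<lambda>j l. g w / (w - zs j) ^ (l + 1))) z =
        g w * ((1 - P z / P w) / (w - z))"
      using poly_multipoint_poly_cmult[of p zs m "g w" "\<lambda>j l. 1 / (w - zs j) ^ (l + 1)" z]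
        multipoint_poly_kernel[OF inj w pos] by (simp add: P)
    then show "poly (multipoint_poly p zs m (\<lambda>j l. g w / (w - zs j) ^ (l + 1))) z =
        g w / (w - z) - P z * (g w / ((w - z) * P w))"
      by (simp add: diff_divide_distrib right_diff_distrib mult_ac)
  qed
  also have "\<dots> = contour_integral \<gamma> (\<lambda>w. g w / (w - z)) - P z * contour_integral \<gamma> (\<lambda>w. g w / ((w - z) * P w))"
  proof -
    have "(\<lambda>w. g w / (w - z)) contour_integrable_on \<gamma>" "(\<lambda>w. g w / ((w - z) * P w)) contour_integrable_on \<gamma>"
      using Pnz by (intro int holomorphic_intros g' P'; auto)+
    then show ?thesis
      by (subst contour_integral_diff) (simp_all only: contour_integral_lmul contour_integrable_lmul)
  qed
  finally show ?thesis .
qed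

lemma prod_power_mult:
  fixes x :: "'b \<Rightarrow> 'a::comm_semiring_1"
  shows "(\<Prod>k\<in>A. x k ^ (n * m k)) = (\<Prod>k\<in>A. x k ^ m k) ^ n"
  by (simp add: prod_power_distrib mult.commute flip: power_mult)

text \<open>The degrees are only bounded because leading coefficients can vanish, as for
  \<open>f = 0\<close>. The region between the loops lies in the domain of \<open>f\<close> so that
  Cauchy's formula holds. The two further premises of the limit make the splitting of
  \<open>f\<close> available.\<close>

theorem theorem3p1:
  fixes \<Omega> \<Omega>0 :: "complex set" and f :: "complex \<Rightarrow> complex"
    and p :: nat and zs :: "nat \<Rightarrow> complex" and m :: "nat \<Rightarrow> nat"
    and z :: complex and \<Gamma>1 \<Gamma>2 :: "real \<Rightarrow> complex"
  assumes "open \<Omega>" and "closed \<Omega>0" and "\<Omega>0 \<subseteq> \<Omega>"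
    and "f analytic_on (\<Omega> - \<Omega>0)"
    and "p \<ge> 1"
    and "\<forall>k\<in>{1..p}. zs k \<in> \<Omega>0" and "inj_on zs {1..p}"
    and "\<forall>k\<in>{1..p}. m k \<ge> 1"
    and "z \<in> \<Omega> - \<Omega>0"
    and "ccw_loop_in (\<Omega> - \<Omega>0) \<Gamma>1" and "ccw_loop_in (\<Omega> - \<Omega>0) \<Gamma>2"
    and "encircles \<Gamma>1 (zs ` {1..p})" and "encircles \<Gamma>2 (zs ` {1..p})"
    and "z \<in> outside (path_image \<Gamma>2)"
    and "encircles \<Gamma>1 (path_image \<Gamma>2)" and "encircles \<Gamma>1 {z}"
    and "inside (path_image \<Gamma>1) \<inter> outside (path_image \<Gamma>2) \<subseteq> \<Omega> - \<Omega>0"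
  shows "(\<forall>n. degree (laurent_q p zs m f \<Gamma>1 n) \<le> (\<Sum>k=1..p. m k) - 1) \<and>
         (\<forall>n. degree (laurent_t p zs m f \<Gamma>2 n) \<le> (\<Sum>k=1..p. m k) - 1) \<and>
         (\<forall>N. f z =
            (\<Sum>n<N. poly (laurent_q p zs m f \<Gamma>1 n) z * (\<Prod>k=1..p. (z - zs k) ^ (n * m k)))
          + (\<Sum>n<N. poly (laurent_t p zs m f \<Gamma>2 n) z / (\<Prod>k=1..p. (z - zs k) ^ ((n + 1) * m k)))
          + laurent_remainder p zs m f \<Gamma>1 \<Gamma>2 N z) \<and>
         (z \<in> lemniscate_annulus p zs m \<Omega> \<Omega>0 \<longrightarrow>
            encircles \<Gamma>2 \<Omega>0 \<longrightarrow> inside (path_image \<Gamma>1) \<subseteq> \<Omega> \<longrightarrow>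
            (\<lambda>N. laurent_remainder p zs m f \<Gamma>1 \<Gamma>2 N z) \<longlonglongrightarrow> 0)"
proof -
  let ?S = "\<Omega> - \<Omega>0" and ?Z = "zs ` {1..p}" and ?C = "1 / (2 * of_real pi * \<i>) :: complex"
  note c1 = ccw_loopD[OF assms(10)] and c2 = ccw_loopD[OF assms(11)]
  have S: "open ?S" using assms(1,2) by (rule open_Diff)
  have f: "f holomorphic_on ?S" using assms(4) by (rule analytic_imp_holomorphic)
  have Z: "?Z \<subseteq> \<Omega>0" using assms(6) by blast
  have zZ: "z \<notin> ?Z" using Z assms(9) by blast
  have enc: "path_image \<Gamma>2 \<subseteq> inside (path_image \<Gamma>1)" "z \<in> inside (path_image \<Gamma>1)"
    using assms(15,16) by (auto simp: encircles_def)
  have z1: "z \<notin> path_image \<Gamma>1" and z2: "z \<notin> path_image \<Gamma>2"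
    using enc(2) assms(14) inside_no_overlap outside_no_overlap by blast+
  have pos: "(\<Sum>k=1..p. m k) > 0"
    using assms(5,8) by (intro sum_pos) (auto simp: Suc_le_eq)
  define P where "P = (\<Prod>k\<in>{1..p}. [:- zs k, 1:] ^ m k)"
  have P: "poly P w = (\<Prod>k=1..p. (w - zs k) ^ m k)" for w
    by (simp add: P_def poly_prod)
  have degP: "degree P > 0"
    using pos by (simp add: P_def degree_prod_sum_eq degree_linear_power)
  have P0: "poly P w = 0 \<longleftrightarrow> w \<in> ?Z" for w
    using assms(8) by (force simp: P)
  have Pn: "(\<Prod>k=1..p. (w - zs k) ^ (n * m k)) = poly P w ^ n" for w n
    by (simp add: P prod_power_mult)
  have Pz: "poly P z \<noteq> 0" using P0 zZ by blast
  have PS: "poly P w \<noteq> 0" if "w \<in> ?S" for w using P0 Z that by blast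

  \<comment> \<open>The expansion by telescoping\<close>
  define A where "A n = ?C * contour_integral \<Gamma>1 (\<lambda>w. f w / ((w - z) * poly P w ^ n))" for n
  define B where "B n = ?C * contour_integral \<Gamma>2 (\<lambda>w. poly P w ^ n * (f w / (w - z)))" for n
  have q: "poly (laurent_q p zs m f \<Gamma>1 n) z = A n - poly P z * A (Suc n)" for n
  proof -
    let ?g = "\<lambda>w. f w / poly P w ^ n"
    have "laurent_a p zs m f \<Gamma>1 n = (\<lambda>j l. ?C * contour_integral \<Gamma>1 (\<lambda>w. ?g w / (w - zs j) ^ (l + 1)))"
      unfolding laurent_a_def Pn by (simp add: mult.commute)
    then have "poly (laurent_q p zs m f \<Gamma>1 n) z =
        ?C * (contour_integral \<Gamma>1 (\<lambda>w. ?g w / (w - z))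
          - poly P z * contour_integral \<Gamma>1 (\<lambda>w. ?g w / ((w - z) * poly P w)))"
      unfolding laurent_q_def
      using poly_multipoint_poly_Cauchy_integral[OF assms(7) pos S c1(1,5) _ _ z1 P, of ?g] PS f c1(5) Z
      by (simp only: poly_multipoint_poly_cmult) (intro arg_cong2[where f = times] refl; force intro!: holomorphic_intros)
    then show ?thesis
      by (simp add: A_def right_diff_distrib mult_ac)
  qed
  have t: "poly (laurent_t p zs m f \<Gamma>2 n) z = B (Suc n) - poly P z * B n" for n
  proof -
    \<comment> \<open>Of the \<open>n + 1\<close> factors \<open>poly P w\<close> the denominator of
      the second integral cancels one, which leaves \<open>B n\<close> beside
      \<open>B (Suc n)\<close>.\<close>
    let ?g = "\<lambda>w. poly P w ^ Suc n * f w"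
    have "laurent_b p zs m f \<Gamma>2 n = (\<lambda>j l. ?C * contour_integral \<Gamma>2 (\<lambda>w. ?g w / (w - zs j) ^ (l + 1)))"
      unfolding laurent_b_def Pn by simp
    then have "poly (laurent_t p zs m f \<Gamma>2 n) z =
        ?C * (contour_integral \<Gamma>2 (\<lambda>w. ?g w / (w - z))
          - poly P z * contour_integral \<Gamma>2 (\<lambda>w. ?g w / ((w - z) * poly P w)))"
      unfolding laurent_t_def
      using poly_multipoint_poly_Cauchy_integral[OF assms(7) pos S c2(1,5) _ _ z2 P, of ?g] f c2(5) Z
      by (simp only: poly_multipoint_poly_cmult) (intro arg_cong2[where f = times] refl; force intro!: holomorphic_intros)
    moreover have "contour_integral \<Gamma>2 (\<lambda>w. ?g w / ((w - z) * poly P w))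
        = contour_integral \<Gamma>2 (\<lambda>w. poly P w ^ n * (f w / (w - z)))"
      using PS c2(5) by (intro contour_integral_cong refl) auto
    ultimately show ?thesis
      by (simp add: B_def right_diff_distrib mult_ac)
  qed
  have rem: "laurent_remainder p zs m f \<Gamma>1 \<Gamma>2 N z = A N * poly P z ^ N - B N * (1 / poly P z ^ N)" for N
    unfolding laurent_remainder_def Pn A_def B_def by simp
  have Cauchy: "f z = A 0 - B 0"
  proof -
    have "f z = 1 / (2 * pi * \<i>) * contour_integral \<Gamma>1 (\<lambda>w. f w / (w - z))
        - 1 / (2 * pi * \<i>) * contour_integral \<Gamma>2 (\<lambda>w. f w / (w - z))"
      by (rule Cauchy_formula_ccw_annulus[OF assms(10,11) enc(1) S _ f enc(2) assms(14)])
        (use c1(5) c2(5) assms(17) in blast)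
    then show ?thesis by (simp add: A_def B_def)
  qed
  have expansion: "f z =
      (\<Sum>n<N. poly (laurent_q p zs m f \<Gamma>1 n) z * (\<Prod>k=1..p. (z - zs k) ^ (n * m k)))
    + (\<Sum>n<N. poly (laurent_t p zs m f \<Gamma>2 n) z / (\<Prod>k=1..p. (z - zs k) ^ ((n + 1) * m k)))
    + laurent_remainder p zs m f \<Gamma>1 \<Gamma>2 N z" for N
  proof -
    have "(\<Sum>n<N. poly (laurent_q p zs m f \<Gamma>1 n) z * poly P z ^ n) = A 0 - A N * poly P z ^ N"
      by (induction N) (simp_all add: q algebra_simps)
    moreover have "(\<Sum>n<N. poly (laurent_t p zs m f \<Gamma>2 n) z / poly P z ^ (n + 1)) = B N / poly P z ^ N - B 0"
    proof -
      have "poly (laurent_t p zs m f \<Gamma>2 n) z / poly P z ^ (n + 1) =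
          B (Suc n) / poly P z ^ Suc n - B n / poly P z ^ n" for n
        using Pz by (simp add: t diff_divide_distrib)
      then show ?thesis
        using sum_lessThan_telescope[of "\<lambda>n. B n / poly P z ^ n" N] by simp
    qed
    ultimately show ?thesis
      unfolding Pn rem using Cauchy by simp
  qed

  \<comment> \<open>Convergence in the lemniscate annulus\<close>
  have conv: "(\<lambda>N. laurent_remainder p zs m f \<Gamma>1 \<Gamma>2 N z) \<longlonglongrightarrow> 0"
    if ann: "z \<in> lemniscate_annulus p zs m \<Omega> \<Omega>0" and enc2: "encircles \<Gamma>2 \<Omega>0"
      and ins1: "inside (path_image \<Gamma>1) \<subseteq> \<Omega>"
  proof -
    let ?I1 = "inside (path_image \<Gamma>1)" and ?I2 = "inside (path_image \<Gamma>2)" and ?O2 = "outside (path_image \<Gamma>2)"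
    have normP: "(\<Prod>k=1..p. norm (w - zs k) ^ m k) = norm (poly P w)" for w
      unfolding P by (simp add: prod_norm flip: norm_power)
    have \<Omega>0: "\<Omega>0 \<subseteq> ?I2" using enc2 by (simp add: encircles_def)
    have sub: "?I2 \<subseteq> ?I1"
      using c1 c2 enc(1) by (intro inside_inside_compact_connected) (auto intro: compact_imp_closed)
    have roots: "{w. poly P w = 0} \<subseteq> ?I1" "{w. poly P w = 0} \<subseteq> ?I2"
      using P0 Z \<Omega>0 sub by blast+
    have "lemniscate_r2 p zs m \<Omega>0 < ereal (norm (poly P z))" "ereal (norm (poly P z)) < lemniscate_r1 p zs m \<Omega>"
      using ann unfolding lemniscate_annulus_def normP by simp_all
    \<comment> \<open>Real levels are inserted because \<open>lemniscate_r1\<close> may be infinite;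
      the strict gaps give \<open>norm (poly P w) < \<rho>2\<close> on \<open>\<Omega>0\<close> and
      put the sublevel set of \<open>\<rho>1\<close> into \<open>\<Omega>\<close>.\<close>
    then obtain \<rho>2 \<rho>1 where \<rho>2: "lemniscate_r2 p zs m \<Omega>0 < ereal \<rho>2" "\<rho>2 < norm (poly P z)"
      and \<rho>1: "norm (poly P z) < \<rho>1" "ereal \<rho>1 < lemniscate_r1 p zs m \<Omega>"
      by (metis ereal_dense2 less_ereal.simps(1))
    have r2: "norm (poly P w) < \<rho>2" if "w \<in> \<Omega>0" for w
    proof -
      have "ereal (norm (poly P w)) \<le> lemniscate_r2 p zs m \<Omega>0"
        unfolding lemniscate_r2_def normP using that by (intro SUP_upper)
      then show ?thesis using \<rho>2(1) by (metis le_less_trans less_ereal.simps(1))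
    qed
    have r1: "w \<in> \<Omega>" if "norm (poly P w) < \<rho>1" for w
    proof (rule ccontr)
      assume "w \<notin> \<Omega>"
      then have "lemniscate_r1 p zs m \<Omega> \<le> ereal (norm (poly P w))"
        unfolding lemniscate_r1_def normP by (intro INF_lower) auto
      then have "\<rho>1 < norm (poly P w)" using \<rho>1(2) by (metis less_le_trans less_ereal.simps(1))
      then show False using that by simp
    qed
    have "zs 1 \<in> \<Omega>0" using assms(5,6) by auto
    then have "\<rho>2 > 0" using r2 by (meson norm_ge_zero order_le_less_trans)
    obtain f1 f2 R K where f1: "f1 holomorphic_on \<Omega>" and f2: "f2 holomorphic_on - \<Omega>0"
      and bd: "\<And>w. R \<le> norm w \<Longrightarrow> norm (f2 w) \<le> K"
      and split: "\<And>w. w \<in> path_image \<Gamma>1 \<union> path_image \<Gamma>2 \<Longrightarrow> f w = f1 w + f2 w"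
      using Laurent_splitting[OF assms(1,2) f assms(10,11) enc(1) \<Omega>0 ins1] by metis
    have disc: "path_image \<Gamma>1 \<union> ?I1 \<subseteq> \<Omega>" using c1(5) ins1 by blast
    have im2: "path_image \<Gamma>2 \<union> ?O2 \<subseteq> - \<Omega>0"
      using c2(5) \<Omega>0 inside_Int_outside by blast
    have int1: "h contour_integrable_on \<Gamma>1" if "h holomorphic_on ?S - {z}" for h
      using that S c1(1,5) z1 by (intro contour_integrable_holomorphic_simple[of h "?S - {z}"]) auto
    have int2: "h contour_integrable_on \<Gamma>2" if "h holomorphic_on ?S - {z}" for h
      using that S c2(1,5) z2 by (intro contour_integrable_holomorphic_simple[of h "?S - {z}"]) auto
    have f12: "f1 holomorphic_on ?S - {z}" "f2 holomorphic_on ?S - {z}"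
      using f1 f2 by (auto elim!: holomorphic_on_subset)
    \<comment> \<open>All singularities of the \<open>f2\<close> part lie inside
      \<open>\<Gamma>1\<close>, so its integral vanishes by going to infinity. The quadratic decay
      takes one factor from \<open>P ^ n\<close>, hence \<open>n > 0\<close>.\<close>
    have A1: "A n = ?C * contour_integral \<Gamma>1 (\<lambda>w. f1 w / ((w - z) * poly P w ^ n))" if "n > 0" for n
    proof -
      have "degree (P ^ n) > 0"
        using degP that by (subst degree_power_eq) auto
      then obtain R' C' where "\<And>w. R' \<le> norm w \<Longrightarrow> norm (f2 w / ((w - z) * poly (P ^ n) w)) \<le> C' / norm w ^ 2"
        using inverse_square_bound[of "P ^ n" R f2 K z] bd by blast
      then have R': "\<And>w. R' \<le> norm w \<Longrightarrow> norm (f2 w / ((w - z) * poly P w ^ n)) \<le> C' / norm w ^ 2"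
        by (simp only: poly_power)
      have "contour_integral \<Gamma>1 (\<lambda>w. f2 w / ((w - z) * poly P w ^ n)) =
          - (2 * pi * \<i> * (\<Sum>x\<in>{} \<inter> outside (path_image \<Gamma>1). residue (\<lambda>w. f2 w / ((w - z) * poly P w ^ n)) x))"
      proof (rule Residue_theorem_ccw_exterior[OF assms(10) _ _ _ _ _ R'])
        show "open (- \<Omega>0 - {z})" using assms(2) by auto
        have "w \<notin> ?I1" if "w \<in> path_image \<Gamma>1 \<union> outside (path_image \<Gamma>1)" for w
          using that inside_no_overlap inside_Int_outside by blast
        then show "path_image \<Gamma>1 \<union> outside (path_image \<Gamma>1) \<subseteq> - \<Omega>0 - {z}"
          using \<Omega>0 sub enc(2) by blast
        show "(\<lambda>w. f2 w / ((w - z) * poly P w ^ n)) holomorphic_on - \<Omega>0 - {z} - {}"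
          using P0 Z by (intro holomorphic_intros holomorphic_on_subset[OF f2]) auto
      qed auto
      then have 0: "contour_integral \<Gamma>1 (\<lambda>w. f2 w / ((w - z) * poly P w ^ n)) = 0" by simp
      have "contour_integral \<Gamma>1 (\<lambda>w. f w / ((w - z) * poly P w ^ n)) =
          contour_integral \<Gamma>1 (\<lambda>w. f1 w / ((w - z) * poly P w ^ n) + f2 w / ((w - z) * poly P w ^ n))"
        using split by (intro contour_integral_cong refl) (simp add: add_divide_distrib)
      also have "\<dots> = contour_integral \<Gamma>1 (\<lambda>w. f1 w / ((w - z) * poly P w ^ n)) + 0"
        using PS by (subst contour_integral_add) (auto intro!: int1 holomorphic_intros f12 simp: 0)
      finally show ?thesis by (simp add: A_def)
    qed
    have "eventually (\<lambda>n. ?C * (contour_integral \<Gamma>1 (\<lambda>w. f1 w / ((w - z) * poly P w ^ n)) * poly P z ^ n)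
        = A n * poly P z ^ n) sequentially"
      by (intro eventually_mono[OF eventually_gt_at_top[of 0]]) (simp add: A1)
    moreover have "(\<lambda>n. ?C * (contour_integral \<Gamma>1 (\<lambda>w. f1 w / ((w - z) * poly P w ^ n)) * poly P z ^ n)) \<longlonglongrightarrow> 0"
      using r1 \<rho>1(1)
      by (intro tendsto_mult_right_zero inner_remainder_tendsto_0[OF degP assms(10,1) disc f1 roots(1) enc(2)]) auto
    ultimately have limA: "(\<lambda>n. A n * poly P z ^ n) \<longlonglongrightarrow> 0"
      by (rule Lim_transform_eventually[rotated])
    \<comment> \<open>The \<open>f1\<close> part is analytic on and inside \<open>\<Gamma>2\<close>,
      as \<open>z\<close> lies outside; it drops out for every \<open>n\<close>, including
      0.\<close>
    have B2: "B n = ?C * contour_integral \<Gamma>2 (\<lambda>w. poly P w ^ n * (f2 w / (w - z)))" for n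
    proof -
      have "contour_integral \<Gamma>2 (\<lambda>w. poly P w ^ n * (f1 w / (w - z))) =
          2 * pi * \<i> * (\<Sum>x\<in>{} \<inter> ?I2. residue (\<lambda>w. poly P w ^ n * (f1 w / (w - z))) x)"
      proof (rule Residue_theorem_ccw_disc[OF assms(11)])
        show "open (\<Omega> - {z})" using assms(1) by auto
        have "z \<notin> ?I2" using assms(14) inside_Int_outside by blast
        then show "path_image \<Gamma>2 \<union> ?I2 \<subseteq> \<Omega> - {z}"
          using enc(1) sub ins1 z2 by blast
        show "(\<lambda>w. poly P w ^ n * (f1 w / (w - z))) holomorphic_on \<Omega> - {z} - {}"
          by (intro holomorphic_intros holomorphic_on_subset[OF f1]) auto
      qed auto
      then have 0: "contour_integral \<Gamma>2 (\<lambda>w. poly P w ^ n * (f1 w / (w - z))) = 0" by simp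
      have "contour_integral \<Gamma>2 (\<lambda>w. poly P w ^ n * (f w / (w - z))) =
          contour_integral \<Gamma>2 (\<lambda>w. poly P w ^ n * (f1 w / (w - z)) + poly P w ^ n * (f2 w / (w - z)))"
        using split by (intro contour_integral_cong refl) (simp add: add_divide_distrib distrib_left)
      also have "\<dots> = 0 + contour_integral \<Gamma>2 (\<lambda>w. poly P w ^ n * (f2 w / (w - z)))"
        by (subst contour_integral_add) (auto intro!: int2 holomorphic_intros f12 simp: 0[simplified])
      finally show ?thesis by (simp add: B_def)
    qed
    have "(\<lambda>n. contour_integral \<Gamma>2 (\<lambda>w. poly P w ^ n * (f2 w / (w - z))) * (1 / poly P z ^ n)) \<longlonglongrightarrow> 0"
    proof (rule outer_remainder_tendsto_0[OF degP assms(11) _ im2 f2 bd roots(2) assms(14) _ \<rho>2(2) \<open>\<rho>2 > 0\<close>])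
      show "open (- \<Omega>0)" using assms(2) by auto
      show "{w. norm (poly P w) > \<rho>2} \<subseteq> - \<Omega>0" using r2 by force
    qed
    then have "(\<lambda>n. ?C * (contour_integral \<Gamma>2 (\<lambda>w. poly P w ^ n * (f2 w / (w - z))) * (1 / poly P z ^ n))) \<longlonglongrightarrow> 0"
      by (rule tendsto_mult_right_zero)
    then have limB: "(\<lambda>n. B n * (1 / poly P z ^ n)) \<longlonglongrightarrow> 0"
      by (simp only: B2 mult.assoc)
    show ?thesis
      unfolding rem using tendsto_diff[OF limA limB] by simp
  qed
  show ?thesis
    using expansion conv degree_multipoint_poly
    unfolding laurent_q_def laurent_t_def by blast
qed

end
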